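(* Let $0<p\le\infty$ and $0<\lambda\le 1$, and let $\mu$ be a finite positive Borel measure on $[0,1)$. Let $X$ be a Banach space of analytic functions on $\mathbb{D}$, continuously embedded in $H(\mathbb{D})$, with $L^{2,\lambda}\subseteq X\subseteq \mathcal{B}^{\frac{3-\lambda}{2}}$. Then $\mathcal{C}_\mu(H^p)\subseteq X$ if and only if $\mu$ is a $\left(\frac{1+\lambda}{2}+\frac1p\right)$-Carleson measure (with the convention $\frac1p=0$ when $p=\infty$).
   Context: $\mathbb{D}$ is the open unit disc and $H(\mathbb{D})$ the space of analytic functions on $\mathbb{D}$. For a finite positive Borel measure $\mu$ on $[0,1)$, let $\mu_n=\int_{[0,1)}t^n\,d\mu(t)$; the Cesàro-like operator is $\mathcal{C}_\mu(f)(z)=\sum_{n\ge0}\big(\mu_n\sum_{k=0}^n a_k\big)z^n=\int_{[0,1)}\frac{f(tz)}{1-tz}\,d\mu(t)$ for $f(z)=\sum_{n\ge 0} a_nz^n\in H(\mathbb{D})$. For $s>0$, $\mu$ is an $s$-Carleson measure if there is $C>0$ with $\mu([t,1))\le C(1-t)^s$ for all $t\in[0,1)$. For $\alpha>0$, the Bloch-type space $\mathcal{B}^\alpha$ consists of $f\in H(\mathbb{D})$ with $\|f\|_{\mathcal{B}^\alpha}=|f(0)|+\sup_{z\in\mathbb{D}}(1-|z|^2)^\alpha|f'(z)|<\infty$. $H^p$ ($0<p\le\infty$) is the Hardy space. For $0<\lambda\le1$, the Morrey space $L^{2,\lambda}$ is the set of $f\in H^2$ with $\|f\|_{L^{2,\lambda}}=|f(0)|+\sup_{I\subset\partial\mathbb{D}}\big(|I|^{-\lambda}\int_I|f(e^{i\theta})-f_I|^2d\theta\big)^{1/2}<\infty$,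 where $I$ ranges over arcs, $|I|$ is arc length and $f_I$ is the mean of the boundary function $f$ over $I$ ($L^{2,1}=BMOA$). *)

theory Defs
  imports "HOL-Analysis.Analysis"
begin

text \<open>Convention: an analytic function on the unit disc is represented by a function
  complex \<Rightarrow> complex that is holomorphic on the open unit disc and vanishes outside
  it (so that function spaces are sets of such representatives).\<close>

definition unit_disc :: "complex set" where
  "unit_disc = ball 0 1"

definition analytic_disc :: "(complex \<Rightarrow> complex) \<Rightarrow> bool" where
  "analytic_disc f \<longleftrightarrow> f holomorphic_on unit_disc \<and> (\<forall>z. z \<notin> unit_disc \<longrightarrow> f z = 0)"

definition hardy :: "ereal \<Rightarrow> (complex \<Rightarrow> complex) set" where
  "hardy p = {f. analytic_disc f \<and>
     (if p = \<infinity> then (\<exists>M. \<forall>z\<in>unit_disc. norm (f z) \<le> M)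
      else (\<exists>M::real. \<forall>r\<in>{0<..<1}.
              (\<integral>\<^sup>+ \<theta>\<in>{0..2*pi}. ennreal (norm (f (of_real r * cis \<theta>)) powr real_of_ereal p) \<partial>lborel)
              \<le> ennreal M))}"

definition bdry :: "(complex \<Rightarrow> complex) \<Rightarrow> real \<Rightarrow> complex" where
  "bdry f \<theta> = Lim (at_left 1) (\<lambda>r::real. f (of_real r * cis \<theta>))"

definition arc_mean :: "(complex \<Rightarrow> complex) \<Rightarrow> real \<Rightarrow> real \<Rightarrow> complex" where
  "arc_mean f a l = (1 / of_real l) * (\<integral>\<theta>\<in>{a..a+l}. bdry f \<theta> \<partial>lborel)"

definition morrey :: "real \<Rightarrow> (complex \<Rightarrow> complex) set" where
  "morrey lam = {f. f \<in> hardy 2 \<and>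
     (\<exists>M::real. \<forall>a l. 0 < l \<and> l \<le> 2*pi \<longrightarrow>
        (\<integral>\<^sup>+ \<theta>\<in>{a..a+l}. ennreal ((norm (bdry f \<theta> - arc_mean f a l))\<^sup>2) \<partial>lborel)
          \<le> ennreal (M * l powr lam))}"

definition bloch_type :: "real \<Rightarrow> (complex \<Rightarrow> complex) set" where
  "bloch_type \<alpha> = {f. analytic_disc f \<and>
     (\<exists>M. \<forall>z\<in>unit_disc. (1 - (norm z)\<^sup>2) powr \<alpha> * norm (deriv f z) \<le> M)}"

definition cesaro_like :: "real measure \<Rightarrow> (complex \<Rightarrow> complex) \<Rightarrow> (complex \<Rightarrow> complex)" where
  "cesaro_like mu f z = (if z \<in> unit_disc then
      (\<integral>t. f (of_real t * z) / (1 - of_real t * z) \<partial>mu) else 0)"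

definition carleson :: "real measure \<Rightarrow> real \<Rightarrow> bool" where
  "carleson mu s \<longleftrightarrow> (\<exists>C>0. \<forall>t\<in>{0..<1}. measure mu {t..<1} \<le> C * (1 - t) powr s)"

text \<open>A Banach space (X, N) of analytic functions on the disc, continuously embedded
  in H(D) (i.e. point evaluations are uniformly bounded on compact subsets of D).\<close>
definition banach_analytic_space ::
    "(complex \<Rightarrow> complex) set \<Rightarrow> ((complex \<Rightarrow> complex) \<Rightarrow> real) \<Rightarrow> bool" where
  "banach_analytic_space X N \<longleftrightarrow>
     (\<forall>f\<in>X. analytic_disc f) \<and>
     (\<lambda>z. 0) \<in> X \<and>
     (\<forall>f\<in>X. \<forall>g\<in>X. (\<lambda>z. f z + g z) \<in> X) \<and>
     (\<forall>f\<in>X. \<forall>c::complex. (\<lambda>z. c * f z) \<in> X) \<and>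
     (\<forall>f\<in>X. 0 \<le> N f) \<and>
     (\<forall>f\<in>X. N f = 0 \<longleftrightarrow> f = (\<lambda>z. 0)) \<and>
     (\<forall>f\<in>X. \<forall>c::complex. N (\<lambda>z. c * f z) = norm c * N f) \<and>
     (\<forall>f\<in>X. \<forall>g\<in>X. N (\<lambda>z. f z + g z) \<le> N f + N g) \<and>
     (\<forall>F. (\<forall>n. F n \<in> X) \<and>
          (\<forall>e>0. \<exists>K. \<forall>m\<ge>K. \<forall>n\<ge>K. N (\<lambda>z. F m z - F n z) < e)
        \<longrightarrow> (\<exists>g\<in>X. (\<lambda>n. N (\<lambda>z. F n z - g z)) \<longlonglongrightarrow> 0)) \<and>
     (\<forall>K. compact K \<and> K \<subseteq> unit_disc \<longrightarrow>
          (\<exists>C. \<forall>f\<in>X. \<forall>z\<in>K. norm (f z) \<le> C * N f))"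

definition inv_exp :: "ereal \<Rightarrow> real" where
  "inv_exp p = (if p = \<infinity> then 0 else 1 / real_of_ereal p)"

end

theory Submission
  imports Defs "HOL-Complex_Analysis.Complex_Analysis"
begin

text \<open>Necessity. Suppose \<open>\<mu>\<close> is not Carleson and choose points \<open>a\<^sub>j\<close> at which the Carleson ratio
  exceeds \<open>16\<^sup>j\<close>. Superposing the functions \<open>((1 - a\<^sub>j\<^sup>2) / (1 - a\<^sub>j z)\<^sup>2)\<^bsup>1/p\<^esup>\<close> with weights \<open>4\<^sup>-\<^sup>j\<close>
  gives a function of \<open>H\<^sup>p\<close> that is positive and increasing on \<open>[0,1)\<close>. By positivity no
  cancellation occurs, so the derivative of its image at \<open>a\<^sub>j\<close> dominates the contribution of the
  \<open>j\<close>-th summand, and the Bloch condition fails; no closed graph theorem is needed.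

  Sufficiency. Only the growth \<open>|f(z)| \<le> C (1 - |z|)\<^bsup>-1/p\<^esup>\<close> of a function of \<open>H\<^sup>p\<close> is used. For an arc
  of length \<open>2\<pi>\<eta>\<close> starting at \<open>\<theta>\<^sub>0\<close>, the boundary values of \<open>F = C\<^sub>\<mu> f\<close> are compared with
  \<open>F((1 - \<eta>) e\<^bsup>i\<theta>\<^sub>0\<^esup>)\<close>: the part \<open>1 - t \<le> \<eta>\<close> of the integral is estimated by size, the part
  \<open>1 - t \<ge> \<eta>\<close> by Cauchy's estimate for the derivative of \<open>f(w) / (1 - w)\<close>. With
  \<open>|1 - t e\<^bsup>i\<theta>\<^esup>| \<ge> (1 - t)\<^bsup>1-b\<^esup> (|1 - e\<^bsup>i\<theta>\<^esup>| / 2)\<^sup>b\<close> for a suitable \<open>b < 1/2\<close>, the Carleson condition bounds the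
  difference by \<open>\<eta>\<^bsup>(\<lambda>-1)/2\<^esup> (1 + (\<eta> / |1 - e\<^bsup>i\<theta>\<^esup>|)\<^sup>b)\<close>, whose mean square over the arc is of order
  \<open>\<eta>\<^bsup>\<lambda>-1\<^esup>\<close>.\<close>

subsection \<open>Growth of Hardy functions\<close>

text \<open>Contour integrals and primitives are evaluated as gauge integrals, whereas
  \<open>hardy\<close> and \<open>morrey\<close> are defined by set integrals over
  \<open>lborel\<close>; this is the bridge.\<close>

lemma nn_integral_Icc_eq_of_has_integral:
  fixes h :: "real \<Rightarrow> real"
  assumes "h \<in> borel_measurable borel" "\<And>x. 0 \<le> h x" "(h has_integral I) {a..b}"
  shows "(\<integral>\<^sup>+x\<in>{a..b}. ennreal (h x) \<partial>lborel) = ennreal I"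
proof -
  have "(\<integral>\<^sup>+x. ennreal (h x * indicator {a..b} x) \<partial>lborel) = ennreal I"
    by (rule nn_integral_has_integral_lborel)
       (use assms has_integral_restrict_UNIV[of "{a..b}" h] in \<open>auto simp: indicator_times_eq_if(2)[of h]\<close>)
  then show ?thesis by (simp add: ennreal_mult' ennreal_indicator assms)
qed

lemma borel_measurable_cis [measurable]: "cis \<in> borel_measurable borel"
  by (intro borel_measurable_continuous_onI continuous_intros)

text \<open>Cauchy's formula on the circle of radius \<open>\<rho>\<close>, with
  \<open>\<rho> - norm z\<close> as lower bound for the denominator. Hypothesis \<open>B\<close>
  trades the modulus of f for its q-th power, since for q < 1 the q-th means do not control the
  integral of the modulus itself.\<close>

lemma norm_le_of_circle_powr_bound:
  fixes f :: "complex \<Rightarrow> complex"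
  assumes holf: "f holomorphic_on ball 0 1" and z: "norm z < \<rho>" and \<rho>: "\<rho> < 1"
    and B: "\<And>w. norm w = \<rho> \<Longrightarrow> norm (f w) \<le> B * norm (f w) powr q" "0 \<le> B"
    and M: "(\<integral>\<^sup>+\<theta>\<in>{0..2*pi}. ennreal (norm (f (of_real \<rho> * cis \<theta>)) powr q) \<partial>lborel) \<le> ennreal M"
    and "0 \<le> M" and q: "0 < q"
  shows "norm (f z) \<le> B * M / (\<rho> - norm z)"
proof -
  have \<rho>0: "0 < \<rho>" using z norm_ge_zero[of z] by linarith
  have "f holomorphic_on cball 0 \<rho>"
    using holf by (rule holomorphic_on_subset) (use \<rho> in auto)
  then have "((\<lambda>u. f u / (u - z)) has_contour_integral 2 * of_real pi * \<i> * f z) (circlepath 0 \<rho>)"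
    by (rule Cauchy_integral_circlepath_simple) (use z in auto)
  then have I: "((\<lambda>t. f (of_real \<rho> * cis t) / (of_real \<rho> * cis t - z) * of_real \<rho> * \<i> * cis t)
      has_integral 2 * of_real pi * \<i> * f z) {0..2*pi}"
    by (subst (asm) circlepath_def, subst (asm) has_contour_integral_part_circlepath_iff) auto
  define h where "h \<equiv> \<lambda>\<theta>::real. norm (f (of_real \<rho> * cis \<theta>)) powr q"
  have "continuous_on UNIV (\<lambda>\<theta>::real. f (of_real \<rho> * cis \<theta>))"
    by (rule continuous_on_compose2[OF holomorphic_on_imp_continuous_on[OF holf]])
       (use \<rho> \<rho>0 in \<open>auto intro!: continuous_intros simp: norm_mult\<close>)
  then have conth: "continuous_on UNIV h"
    unfolding h_def by (intro continuous_intros continuous_on_powr') (use q in auto)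
  have "h integrable_on {0..2*pi}"
    by (rule integrable_continuous_interval) (rule continuous_on_subset[OF conth], simp)
  then have hint: "(h has_integral integral {0..2*pi} h) {0..2*pi}"
    by (rule integrable_integral)
  have h0: "0 \<le> h \<theta>" for \<theta> by (simp add: h_def)
  have I': "(\<integral>\<^sup>+\<theta>\<in>{0..2*pi}. ennreal (h \<theta>) \<partial>lborel) = ennreal (integral {0..2*pi} h)"
    by (rule nn_integral_Icc_eq_of_has_integral[OF borel_measurable_continuous_onI[OF conth] h0 hint])
  have "(\<integral>\<^sup>+\<theta>\<in>{0..2*pi}. ennreal (h \<theta>) \<partial>lborel) \<le> ennreal M"
    using M by (simp add: h_def)
  then have hM: "integral {0..2*pi} h \<le> M" unfolding I' using \<open>0 \<le> M\<close> by simp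
  have "norm (2 * of_real pi * \<i> * f z) \<le> integral {0..2*pi} (\<lambda>\<theta>. B / (\<rho> - norm z) * h \<theta>)"
  proof (subst integral_unique[OF I, symmetric], rule integral_norm_bound_integral)
    fix t :: real
    have 1: "norm (of_real \<rho> * cis t) = \<rho>" using \<rho>0 by (simp add: norm_mult)
    then have 2: "\<rho> - norm z \<le> norm (of_real \<rho> * cis t - z)"
      by (metis norm_triangle_ineq2)
    have "norm (f (of_real \<rho> * cis t) / (of_real \<rho> * cis t - z) * of_real \<rho> * \<i> * cis t)
        = norm (f (of_real \<rho> * cis t)) / norm (of_real \<rho> * cis t - z) * \<rho>"
      using \<rho>0 by (simp add: norm_mult norm_divide)
    also have "\<dots> \<le> (B * h t) / (\<rho> - norm z) * 1"
      using B(1)[OF 1] B(2) h0 2 z \<rho> \<rho>0 unfolding h_def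
      by (intro mult_mono frac_le) auto
    finally show "norm (f (of_real \<rho> * cis t) / (of_real \<rho> * cis t - z) * of_real \<rho> * \<i> * cis t)
      \<le> B / (\<rho> - norm z) * h t" by simp
  next
    show "(\<lambda>\<theta>. B / (\<rho> - norm z) * h \<theta>) integrable_on {0..2*pi}"
      using hint by (intro integrable_on_mult_right) auto
  qed (use I in auto)
  also have "\<dots> = B / (\<rho> - norm z) * integral {0..2*pi} h" by simp
  also have "\<dots> \<le> B / (\<rho> - norm z) * M"
    using hM B(2) z by (intro mult_left_mono) auto
  finally have *: "2 * pi * norm (f z) \<le> B * M / (\<rho> - norm z)" by (simp add: norm_mult)
  have "1 * norm (f z) \<le> 2 * pi * norm (f z)"
    by (rule mult_right_mono) (use pi_gt3 in auto)
  with * show ?thesis by simp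
qed

text \<open>Writing \<open>|f| = |f|\<^sup>q |f|\<^bsup>1-q\<^esup>\<close> in Cauchy's formula bounds the weighted supremum \<open>S\<close> by
  a multiple of \<open>S\<^bsup>1-q\<^esup>\<close>; for bounded \<open>f\<close> it is finite a priori, so this bounds \<open>S\<close> itself.\<close>
lemma growth_of_bounded_hardy:
  fixes f :: "complex \<Rightarrow> complex"
  assumes holf: "f holomorphic_on ball 0 1" and q: "0 < q" "q < 1" and "0 \<le> M"
    and M: "\<And>r. r \<in> {0<..<1} \<Longrightarrow>
      (\<integral>\<^sup>+\<theta>\<in>{0..2*pi}. ennreal (norm (f (of_real r * cis \<theta>)) powr q) \<partial>lborel) \<le> ennreal M"
    and L: "\<And>z. norm z < 1 \<Longrightarrow> norm (f z) \<le> L" and z: "norm z < 1"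
  shows "norm (f z) * (1 - norm z) powr (1/q) \<le> (M * 2 powr (1/q)) powr (1/q)"
proof -
  define \<Phi> where "\<Phi> \<equiv> \<lambda>z. norm (f z) * (1 - norm z) powr (1/q)"
  define S where "S = (SUP z\<in>ball 0 1. \<Phi> z)"
  have bdd: "bdd_above (\<Phi> ` ball 0 1)"
  proof (rule bdd_aboveI2)
    fix z :: complex assume "z \<in> ball 0 1"
    then have "norm (f z) \<le> L" "(1 - norm z) powr (1/q) \<le> 1" using L q by (auto intro!: powr_le1)
    then show "\<Phi> z \<le> L * 1"
      unfolding \<Phi>_def by (intro mult_mono) (auto intro: order_trans[OF norm_ge_zero])
  qed
  have leS: "\<Phi> w \<le> S" if "norm w < 1" for w
    unfolding S_def using bdd that by (intro cSUP_upper) auto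
  have S0: "0 \<le> S" using leS[of 0] by (simp add: \<Phi>_def) (meson norm_ge_zero order_trans)
  have "\<Phi> w \<le> S powr (1-q) * (M * 2 powr (1/q))" if w: "norm w < 1" for w
  proof (cases "S = 0")
    case True
    then show ?thesis using leS[OF w] by simp
  next
    case False
    with S0 have Spos: "0 < S" by simp
    \<comment> \<open>The circle is taken halfway between w and the unit circle, so that
      \<open>\<rho> - norm w\<close> and \<open>1 - \<rho>\<close> are both
      \<open>d\<close>.\<close>
    define d where "d = (1 - norm w) / 2"
    have d: "0 < d" using w by (simp add: d_def)
    define \<rho> where "\<rho> = norm w + d"
    have \<rho>: "norm w < \<rho>" "\<rho> < 1" "1 - \<rho> = d" "0 < \<rho>" using d norm_ge_zero[of w]
      by (auto simp: \<rho>_def d_def field_simps intro: add_pos_nonneg)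
    have B: "norm (f v) \<le> (S * d powr (-1/q)) powr (1-q) * norm (f v) powr q" if v: "norm v = \<rho>" for v
    proof (cases "f v = 0")
      case False
      have "norm (f v) \<le> S * d powr (-1/q)"
        using leS[of v] v \<rho> d by (simp add: \<Phi>_def powr_minus field_simps)
      then have "norm (f v) powr (1-q) * norm (f v) powr q \<le> (S * d powr (-1/q)) powr (1-q) * norm (f v) powr q"
        using q by (intro mult_right_mono powr_mono2) auto
      then show ?thesis using False by (simp flip: powr_add)
    qed (use q in auto)
    have "norm (f w) \<le> (S * d powr (-1/q)) powr (1-q) * M / (\<rho> - norm w)"
      using norm_le_of_circle_powr_bound[OF holf \<rho>(1,2) B _ M \<open>0 \<le> M\<close> q(1)] \<rho> by auto
    also have "\<dots> = S powr (1-q) * M * (d powr (-(1-q)/q) / d)"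
      using Spos d by (simp add: powr_mult powr_powr \<rho>_def diff_divide_distrib)
    also have "d powr (-(1-q)/q) / d = d powr (-(1-q)/q - 1)"
      using d by (simp add: powr_diff)
    \<comment> \<open>The powers of \<open>d\<close> collect to exactly the one that the weight
      \<open>(2 * d) powr (1/q)\<close> cancels, so the bound is uniform in w.\<close>
    also have "-(1-q)/q - 1 = -1/q" using q by (simp add: field_simps)
    finally have "\<Phi> w \<le> S powr (1-q) * M * d powr (-1/q) * (2 * d) powr (1/q)"
      unfolding \<Phi>_def using \<open>0 \<le> M\<close> by (intro mult_mono) (auto simp: d_def diff_divide_distrib)
    also have "(2 * d) powr (1/q) = 2 powr (1/q) * d powr (1/q)" using d by (simp add: powr_mult)
    finally show ?thesis using d by (simp add: powr_minus field_simps)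
  qed
  then have SS: "S \<le> S powr (1-q) * (M * 2 powr (1/q))"
    unfolding S_def by (intro cSUP_least) auto
  have "S \<le> (M * 2 powr (1/q)) powr (1/q)"
  proof (cases "S = 0")
    case False
    with S0 have Spos: "0 < S" by simp
    have "S powr (1-q) * S powr q \<le> S powr (1-q) * (M * 2 powr (1/q))"
      using SS Spos by (simp flip: powr_add)
    then have "S powr q \<le> M * 2 powr (1/q)"
      using Spos by (simp add: mult_le_cancel_left)
    then have "(S powr q) powr (1/q) \<le> (M * 2 powr (1/q)) powr (1/q)"
      using q by (intro powr_mono2) auto
    then show ?thesis using q Spos by (simp add: powr_powr)
  qed auto
  then show ?thesis using leS[OF z] by (simp add: \<Phi>_def)
qed

text \<open>The dilation of f by R < 1 is bounded, and its mean over the circle of radius r is the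
  mean of f over the circle of radius R r. As the a priori bound L does not enter the constant of
  the bounded case, that constant carries over. With R halfway between \<open>norm z\<close> and 1,
  the distance to the boundary shrinks by at most a factor 2.\<close>

lemma growth_of_hardy_less_one:
  fixes f :: "complex \<Rightarrow> complex"
  assumes holf: "f holomorphic_on ball 0 1" and q: "0 < q" "q < 1" and "0 \<le> M"
    and M: "\<And>r. r \<in> {0<..<1} \<Longrightarrow>
      (\<integral>\<^sup>+\<theta>\<in>{0..2*pi}. ennreal (norm (f (of_real r * cis \<theta>)) powr q) \<partial>lborel) \<le> ennreal M"
    and z: "norm z < 1"
  shows "norm (f z) \<le> (M * 2 powr (1/q)) powr (1/q) * 2 powr (1/q) * (1 - norm z) powr (-1/q)"
proof -
  define R where "R = (1 + norm z) / 2"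
  have R: "0 < R" "R < 1" "norm z < R"
    using z norm_ge_zero[of z] by (simp_all add: R_def add_pos_nonneg)
  define g where "g \<equiv> \<lambda>w. f (of_real R * w)"
  have le: "norm (of_real R * w) \<le> R" if "norm w < 1" for w :: complex
    using R that mult_left_mono[of "norm w" 1 R] by (simp add: norm_mult)
  have sub: "cball (0::complex) R \<subseteq> ball 0 1" using R by auto
  have "compact (f ` cball 0 R)"
    by (intro compact_continuous_image holomorphic_on_imp_continuous_on holomorphic_on_subset[OF holf sub]) auto
  then obtain L where L: "\<And>w. w \<in> cball 0 R \<Longrightarrow> norm (f w) \<le> L"
    by (meson bounded_iff compact_imp_bounded imageI)
  have "norm (g (z / of_real R)) * (1 - norm (z / of_real R)) powr (1/q) \<le> (M * 2 powr (1/q)) powr (1/q)"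
  proof (rule growth_of_bounded_hardy[OF _ q \<open>0 \<le> M\<close>])
    show "g holomorphic_on ball 0 1"
      unfolding g_def
      by (rule holomorphic_on_compose_gen[OF _ holf, unfolded o_def])
         (use le R in \<open>fastforce intro!: holomorphic_intros\<close>)+
    show "norm (g w) \<le> L" if "norm w < 1" for w
      unfolding g_def using le[OF that] by (intro L) auto
    show "(\<integral>\<^sup>+\<theta>\<in>{0..2*pi}. ennreal (norm (g (of_real r * cis \<theta>)) powr q) \<partial>lborel) \<le> ennreal M"
      if "r \<in> {0<..<1}" for r
      using M[of "R * r"] R that mult_strict_mono[of R 1 r 1] by (simp add: g_def mult.assoc)
    show "norm (z / of_real R) < 1" using R by (simp add: norm_divide)
  qed
  then have 1: "norm (f z) * (1 - norm z / R) powr (1/q) \<le> (M * 2 powr (1/q)) powr (1/q)"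
    using R by (simp add: g_def norm_divide)
  have "(1 - norm z) / 2 \<le> (R - norm z) / 1" by (simp add: R_def field_simps)
  also have "\<dots> \<le> (R - norm z) / R" using R by (intro frac_le) auto
  also have "\<dots> = 1 - norm z / R" using R by (simp add: field_simps)
  finally have "norm (f z) * ((1 - norm z) / 2) powr (1/q) \<le> norm (f z) * (1 - norm z / R) powr (1/q)"
    using q z by (intro mult_left_mono powr_mono2) auto
  also note 1
  finally show ?thesis using z
    by (simp add: powr_divide powr_minus field_simps)
qed

text \<open>For finite p, the power f^n with n > p satisfies the integral condition with exponent q
  = p/n < 1 and the same integrals. Taking n-th roots of its growth bound turns the exponent 1/q
  into 1/p, so all finite p reduce to exponents below 1.\<close>

lemma hardy_growth:
  assumes f: "f \<in> hardy p" and "0 < p"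
  obtains C where "0 \<le> C" "\<And>z. norm z < 1 \<Longrightarrow> norm (f z) \<le> C * (1 - norm z) powr (- inv_exp p)"
proof (cases "p = \<infinity>")
  case True
  with f obtain C where C: "\<And>z. norm z < 1 \<Longrightarrow> norm (f z) \<le> C"
    by (auto simp: hardy_def unit_disc_def) (metis dist_0_norm mem_ball)
  show ?thesis
  proof
    show "0 \<le> C" using C[of 0] by (simp) (meson norm_ge_zero order_trans)
    show "norm (f z) \<le> C * (1 - norm z) powr (- inv_exp p)" if "norm z < 1" for z
      using C[OF that] that by (simp add: inv_exp_def True)
  qed
next
  case False
  define P where "P = real_of_ereal p"
  have P: "0 < P" using False \<open>0 < p\<close> by (cases p) (auto simp: P_def)
  from f have holf: "f holomorphic_on ball 0 1"
    by (auto simp: hardy_def analytic_disc_def unit_disc_def)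
  obtain M where M: "\<And>r. r \<in> {0<..<1} \<Longrightarrow>
      (\<integral>\<^sup>+\<theta>\<in>{0..2*pi}. ennreal (norm (f (of_real r * cis \<theta>)) powr P) \<partial>lborel) \<le> ennreal M"
    using f False by (auto simp: hardy_def P_def simp del: greaterThanLessThan_iff)
  obtain n :: nat where n: "P < real n" using reals_Archimedean2 by blast
  then have n0: "0 < n" using P by (cases n) auto
  define q where "q = P / n"
  have q: "0 < q" "q < 1" using P n n0 by (auto simp: q_def)
  \<comment> \<open>The bound M from \<open>hardy\<close> may be a negative real, which
    \<open>ennreal\<close> sends to 0; hence \<open>max M 0\<close>.\<close>
  define C where "C = (max M 0 * 2 powr (1/q)) powr (1/q) * 2 powr (1/q)"
  have C0: "0 \<le> C" by (simp add: C_def)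
  have bd: "norm (f z ^ n) \<le> C * (1 - norm z) powr (-1/q)" if "norm z < 1" for z
    unfolding C_def
  proof (rule growth_of_hardy_less_one[OF _ q])
    show "(\<lambda>z. f z ^ n) holomorphic_on ball 0 1" using holf by (intro holomorphic_intros)
    show "(\<integral>\<^sup>+\<theta>\<in>{0..2*pi}. ennreal (norm (f (of_real r * cis \<theta>) ^ n) powr q) \<partial>lborel) \<le> ennreal (max M 0)"
      if "r \<in> {0<..<1}" for r
    proof -
      have "norm (w ^ n) powr q = norm w powr P" for w :: complex
        using n0 by (cases "w = 0") (simp_all add: norm_power powr_powr q_def flip: powr_realpow)
      moreover have "ennreal M \<le> ennreal (max M 0)" by (intro ennreal_leI) simp
      ultimately show ?thesis using order_trans[OF M[OF that]] by simp
    qed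
  qed (use that in auto)
  have "norm (f z) \<le> C powr (1/n) * (1 - norm z) powr (- inv_exp p)" if z: "norm z < 1" for z
  proof (cases "f z = 0")
    case [simp]: False
    have "norm (f z) = (norm (f z ^ n)) powr (1/n)"
      using n0 by (simp add: norm_power powr_powr flip: powr_realpow)
    also have "\<dots> \<le> (C * (1 - norm z) powr (-1/q)) powr (1/n)"
      using bd[OF z] n0 by (intro powr_mono2) auto
    also have "\<dots> = C powr (1/n) * (1 - norm z) powr (- (1 / (q * n)))"
      using C0 z by (simp add: powr_mult powr_powr)
    also have "q * n = P" using n0 by (simp add: q_def)
    finally show ?thesis using \<open>p \<noteq> \<infinity>\<close> by (simp add: inv_exp_def P_def)
  qed (simp)
  then show ?thesis by (intro that[of "C powr (1/n)"]) auto
qed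

subsection \<open>Integrals against Carleson measures\<close>

locale finite_measure_unit_interval = finite_measure mu for mu :: "real measure" +
  assumes sets_mu: "sets mu = sets (restrict_space borel {0..<1::real})"
begin

lemma space_mu: "space mu = {0..<1}"
  using sets_eq_imp_space_eq[OF sets_mu] by (simp add: space_restrict_space)

lemma measurable_mu_continuous:
  fixes h :: "real \<Rightarrow> 'a::topological_space"
  assumes "continuous_on {0..<1} h" shows "h \<in> borel_measurable mu"
  using borel_measurable_continuous_on_restrict[OF assms] measurable_cong_sets[OF sets_mu refl] by blast

lemma measurable_mu_borel:
  assumes "h \<in> borel_measurable borel" shows "h \<in> borel_measurable mu"
  using measurable_restrict_space1[OF assms] measurable_cong_sets[OF sets_mu refl] by blast

lemma sets_tail: "{t\<in>space mu. 1 - t \<le> x} \<in> sets mu"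
proof -
  have "{t\<in>space mu. 1 - t \<le> x} = {0..<1} \<inter> {1-x..}" by (auto simp: space_mu)
  then show ?thesis by (auto simp: sets_mu sets_restrict_space)
qed

text \<open>For x > 1 the tail is the whole interval and \<open>x powr s\<close> is at least 1.
  Having the bound for every positive x spares the dyadic covers below any truncation at 1.\<close>

lemma carleson_tail:
  assumes "carleson mu s" and "0 \<le> s"
  obtains C where "0 < C" "\<And>x. 0 < x \<Longrightarrow> emeasure mu {t\<in>space mu. 1 - t \<le> x} \<le> ennreal (C * x powr s)"
proof -
  from assms(1) obtain C where C: "0 < C" "\<And>t. t \<in> {0..<1} \<Longrightarrow> measure mu {t..<1} \<le> C * (1 - t) powr s"
    by (auto simp: carleson_def simp del: atLeastLessThan_iff)
  have "measure mu {t\<in>space mu. 1 - t \<le> x} \<le> C * x powr s" if x: "0 < x" for x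
  proof (cases "x \<le> 1")
    case True
    have "{t\<in>space mu. 1 - t \<le> x} = {1-x..<1}" using True by (auto simp: space_mu)
    then show ?thesis using C(2)[of "1-x"] x True by simp
  next
    case False
    have "{t\<in>space mu. 1 - t \<le> x} = {0..<1}" using False by (auto simp: space_mu)
    then have "measure mu {t\<in>space mu. 1 - t \<le> x} \<le> C * 1" using C(2)[of 0] by simp
    also have "\<dots> \<le> C * x powr s"
      using C(1) False \<open>0 \<le> s\<close> by (intro mult_left_mono) (auto intro: ge_one_powr_ge_zero)
    finally show ?thesis .
  qed
  then show ?thesis using C(1) by (intro that[of C]) (auto simp: emeasure_eq_measure intro!: ennreal_leI)
qed

text \<open>The integrand is dominated by the sum of the steps \<open>c k\<close> on the tails
  \<open>1 - t \<le> x k\<close>, and the tail bound turns the integral of this sum into a geometric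
  series. Covering by full tails instead of disjoint shells lets the same argument serve for
  decreasing and for increasing \<open>x k\<close>.\<close>

lemma nn_integral_le_of_tail_cover:
  assumes C: "0 \<le> C" "\<And>x. 0 < x \<Longrightarrow> emeasure mu {t\<in>space mu. 1 - t \<le> x} \<le> ennreal (C * x powr s)"
    and x: "\<And>k. 0 < x k" and c: "\<And>k. 0 \<le> c k" "\<And>k. c k * x k powr s = D * \<rho> ^ k"
    and \<rho>: "0 \<le> \<rho>" "\<rho> < 1" and D: "0 \<le> D"
    and cover: "\<And>t. t \<in> {0..<1} \<Longrightarrow> \<phi> t \<noteq> 0 \<Longrightarrow> \<exists>k::nat. 1 - t \<le> x k \<and> \<phi> t \<le> c k"
  shows "(\<integral>\<^sup>+t. ennreal (\<phi> t) \<partial>mu) \<le> ennreal (C * D / (1 - \<rho>))"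
proof -
  define A where "A k = {t\<in>space mu. 1 - t \<le> x k}" for k
  have [measurable]: "A k \<in> sets mu" for k unfolding A_def by (rule sets_tail)
  have "(\<integral>\<^sup>+t. ennreal (\<phi> t) \<partial>mu) \<le> (\<integral>\<^sup>+t. (\<Sum>k. ennreal (c k) * indicator (A k) t) \<partial>mu)"
  proof (rule nn_integral_mono)
    fix t assume t: "t \<in> space mu"
    show "ennreal (\<phi> t) \<le> (\<Sum>k. ennreal (c k) * indicator (A k) t)"
    proof (cases "\<phi> t = 0")
      case False
      then obtain k where k: "1 - t \<le> x k" "\<phi> t \<le> c k" using cover t by (auto simp: space_mu)
      have "ennreal (\<phi> t) \<le> ennreal (c k) * indicator (A k) t"
        using k t by (auto simp: A_def intro: ennreal_leI)
      also have "\<dots> \<le> (\<Sum>i. ennreal (c i) * indicator (A i) t)"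
        using sum_le_suminf[of "\<lambda>i. ennreal (c i) * indicator (A i) t" "{k}"]
        by (simp del: sum_mult_indicator)
      finally show ?thesis .
    qed simp
  qed
  also have "\<dots> = (\<Sum>k. ennreal (c k) * emeasure mu (A k))"
    by (simp add: nn_integral_suminf nn_integral_cmult_indicator)
  also have "\<dots> \<le> (\<Sum>k. ennreal (C * D * \<rho> ^ k))"
  proof (rule suminf_le)
    fix k
    have "ennreal (c k) * emeasure mu (A k) \<le> ennreal (c k) * ennreal (C * x k powr s)"
      unfolding A_def by (intro mult_left_mono C x) auto
    also have "\<dots> = ennreal (C * (c k * x k powr s))"
      using c(1) C(1) by (simp add: ennreal_mult' mult_ac)
    finally show "ennreal (c k) * emeasure mu (A k) \<le> ennreal (C * D * \<rho> ^ k)"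
      by (simp add: c mult_ac)
  qed auto
  also have "\<dots> = ennreal (C * D / (1 - \<rho>))"
  proof (rule suminf_ennreal_eq)
    show "(\<lambda>k. C * D * \<rho> ^ k) sums (C * D / (1 - \<rho>))"
      using sums_mult[OF geometric_sums[of \<rho>], of "C * D"] \<rho> by simp
  qed (use C D \<rho> in auto)
  finally show ?thesis .
qed

end

lemma ex_dyadic:
  fixes x :: real assumes "1 \<le> x"
  obtains k :: nat where "2 ^ k \<le> x" "x < 2 ^ Suc k"
proof -
  define k where "k = nat \<lfloor>log 2 x\<rfloor>"
  have 0: "0 \<le> log 2 x" using assms by simp
  have k: "real k \<le> log 2 x" "log 2 x < real (Suc k)"
    unfolding k_def using 0 by linarith+
  have "2 ^ k \<le> x" using k(1) assms by (simp add: le_log_iff powr_realpow)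
  moreover have "x < 2 ^ Suc k"
    using k(2) assms by (simp only: log_less_iff powr_realpow)
  ultimately show ?thesis by (rule that)
qed

context finite_measure_unit_interval
begin

text \<open>The shells \<open>\<eta> / 2 ^ Suc k < 1 - t \<le> \<eta> / 2 ^ k\<close> shrink towards
  the singularity. The k-th contributes at most a multiple of
  \<open>2 powr ((\<sigma> - s) * k)\<close>, which is summable because
  \<open>\<sigma> < s\<close>.\<close>

lemma carleson_integral_near:
  assumes "carleson mu s" and \<sigma>: "0 \<le> \<sigma>" "\<sigma> < s"
  obtains K where "0 \<le> K"
    "\<And>\<eta>. 0 < \<eta> \<Longrightarrow> integrable mu (\<lambda>t. (1 - t) powr (-\<sigma>) * indicator {1-\<eta>..} t)"
    "\<And>\<eta>. 0 < \<eta> \<Longrightarrow> (\<integral>t. (1 - t) powr (-\<sigma>) * indicator {1-\<eta>..} t \<partial>mu) \<le> K * \<eta> powr (s - \<sigma>)"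
proof -
  obtain C where C: "0 < C" "\<And>x. 0 < x \<Longrightarrow> emeasure mu {t\<in>space mu. 1 - t \<le> x} \<le> ennreal (C * x powr s)"
    using carleson_tail[OF assms(1)] \<sigma> by auto
  define \<rho> where "\<rho> = 2 powr (\<sigma> - s)"
  have \<rho>: "0 \<le> \<rho>" "\<rho> < 1" using \<sigma> by (auto simp: \<rho>_def powr_less_one)
  define K where "K = C * 2 powr \<sigma> / (1 - \<rho>)"
  have K: "0 \<le> K" using C \<rho> by (simp add: K_def)
  have nn: "(\<integral>\<^sup>+t. ennreal ((1 - t) powr (-\<sigma>) * indicator {1-\<eta>..} t) \<partial>mu) \<le> ennreal (K * \<eta> powr (s - \<sigma>))"
    if \<eta>: "0 < \<eta>" for \<eta>
  proof -
    have "(\<integral>\<^sup>+t. ennreal ((1 - t) powr (-\<sigma>) * indicator {1-\<eta>..} t) \<partial>mu)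
       \<le> ennreal (C * (2 powr \<sigma> * \<eta> powr (s - \<sigma>)) / (1 - \<rho>))"
    proof (rule nn_integral_le_of_tail_cover[OF _ C(2) _ _ _ \<rho>])
      fix k :: nat
      have 1: "\<eta> / 2 ^ Suc k = \<eta> * 2 powr (- real k - 1)" "\<eta> / 2 ^ k = \<eta> * 2 powr (- real k)"
        by (simp_all add: powr_diff powr_minus powr_realpow field_simps)
      have "\<rho> ^ k = 2 powr ((\<sigma> - s) * k)" by (simp add: \<rho>_def powr_powr flip: powr_realpow)
      then show "(\<eta> / 2 ^ Suc k) powr (-\<sigma>) * (\<eta> / 2 ^ k) powr s = 2 powr \<sigma> * \<eta> powr (s - \<sigma>) * \<rho> ^ k"
        unfolding 1 using \<eta> by (simp add: powr_mult powr_powr mult_ac flip: powr_add)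
          (simp add: algebra_simps flip: powr_add)
    next
      fix t :: real assume t: "t \<in> {0..<1}" and "(1 - t) powr (-\<sigma>) * indicator {1-\<eta>..} t \<noteq> 0"
      then have t': "1 - t \<le> \<eta>" by (auto simp: indicator_def split: if_splits)
      have "1 \<le> \<eta> / (1 - t)" using t t' by simp
      then obtain k where k: "2 ^ k \<le> \<eta> / (1 - t)" "\<eta> / (1 - t) < 2 ^ Suc k" by (rule ex_dyadic)
      have "1 - t \<le> \<eta> / 2 ^ k" "\<eta> / 2 ^ Suc k < 1 - t" using k t by (simp_all add: field_simps)
      then show "\<exists>k. 1 - t \<le> \<eta> / 2 ^ k \<and> (1 - t) powr (-\<sigma>) * indicator {1-\<eta>..} t \<le> (\<eta> / 2 ^ Suc k) powr (-\<sigma>)"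
        using \<sigma> \<eta> t' by (intro exI[of _ k]) (auto intro!: powr_mono2')
    qed (use C \<eta> in auto)
    then show ?thesis by (simp add: K_def mult_ac)
  qed
  have meas: "(\<lambda>t. (1 - t) powr (-\<sigma>) * indicator {1-\<eta>..} t) \<in> borel_measurable mu" for \<eta>
    by (rule measurable_mu_borel) measurable
  show ?thesis
  proof (rule that[OF K])
    fix \<eta> :: real assume \<eta>: "0 < \<eta>"
    show 1: "integrable mu (\<lambda>t. (1 - t) powr (-\<sigma>) * indicator {1-\<eta>..} t)"
    proof (rule integrableI_nonneg[OF meas])
      show "(\<integral>\<^sup>+t. ennreal ((1 - t) powr (-\<sigma>) * indicator {1-\<eta>..} t) \<partial>mu) < \<infinity>"
        using nn[OF \<eta>] by (rule le_less_trans) simp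
    qed auto
    show "(\<integral>t. (1 - t) powr (-\<sigma>) * indicator {1-\<eta>..} t \<partial>mu) \<le> K * \<eta> powr (s - \<sigma>)"
      using nn[OF \<eta>] K by (subst (asm) nn_integral_eq_integral[OF 1]) auto
  qed
qed

text \<open>The counterpart with shells
  \<open>\<eta> * 2 ^ k \<le> 1 - t < \<eta> * 2 ^ Suc k\<close> moving away from 1. Now the ratio
  \<open>2 powr (s - \<sigma>)\<close> is below 1 because \<open>s < \<sigma>\<close>, and the shell
  nearest to 1 dominates.\<close>

lemma carleson_integral_far:
  assumes "carleson mu s" and "0 \<le> s" and \<sigma>: "s < \<sigma>"
  obtains K where "0 \<le> K"
    "\<And>\<eta>. 0 < \<eta> \<Longrightarrow> integrable mu (\<lambda>t. (1 - t) powr (-\<sigma>) * indicator {..1-\<eta>} t)"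
    "\<And>\<eta>. 0 < \<eta> \<Longrightarrow> (\<integral>t. (1 - t) powr (-\<sigma>) * indicator {..1-\<eta>} t \<partial>mu) \<le> K * \<eta> powr (s - \<sigma>)"
proof -
  obtain C where C: "0 < C" "\<And>x. 0 < x \<Longrightarrow> emeasure mu {t\<in>space mu. 1 - t \<le> x} \<le> ennreal (C * x powr s)"
    using carleson_tail[OF assms(1,2)] by auto
  define \<rho> where "\<rho> = 2 powr (s - \<sigma>)"
  have \<rho>: "0 \<le> \<rho>" "\<rho> < 1" using \<sigma> by (auto simp: \<rho>_def powr_less_one)
  define K where "K = C * 2 powr s / (1 - \<rho>)"
  have K: "0 \<le> K" using C \<rho> by (simp add: K_def)
  have nn: "(\<integral>\<^sup>+t. ennreal ((1 - t) powr (-\<sigma>) * indicator {..1-\<eta>} t) \<partial>mu) \<le> ennreal (K * \<eta> powr (s - \<sigma>))"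
    if \<eta>: "0 < \<eta>" for \<eta>
  proof -
    have "(\<integral>\<^sup>+t. ennreal ((1 - t) powr (-\<sigma>) * indicator {..1-\<eta>} t) \<partial>mu)
       \<le> ennreal (C * (2 powr s * \<eta> powr (s - \<sigma>)) / (1 - \<rho>))"
    proof (rule nn_integral_le_of_tail_cover[OF _ C(2) _ _ _ \<rho>])
      fix k :: nat
      have 1: "\<eta> * 2 ^ Suc k = \<eta> * 2 powr (real k + 1)" "\<eta> * 2 ^ k = \<eta> * 2 powr (real k)"
        by (simp_all add: powr_add powr_realpow field_simps)
      have "\<rho> ^ k = 2 powr ((s - \<sigma>) * k)" by (simp add: \<rho>_def powr_powr flip: powr_realpow)
      then show "(\<eta> * 2 ^ k) powr (-\<sigma>) * (\<eta> * 2 ^ Suc k) powr s = 2 powr s * \<eta> powr (s - \<sigma>) * \<rho> ^ k"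
        unfolding 1 using \<eta> by (simp add: powr_mult powr_powr mult_ac flip: powr_add)
          (simp add: algebra_simps flip: powr_add)
    next
      fix t :: real assume t: "t \<in> {0..<1}" and "(1 - t) powr (-\<sigma>) * indicator {..1-\<eta>} t \<noteq> 0"
      then have t': "\<eta> \<le> 1 - t" by (auto simp: indicator_def split: if_splits)
      have "1 \<le> (1 - t) / \<eta>" using \<eta> t' by simp
      then obtain k where k: "2 ^ k \<le> (1 - t) / \<eta>" "(1 - t) / \<eta> < 2 ^ Suc k" by (rule ex_dyadic)
      have "1 - t \<le> \<eta> * 2 ^ Suc k" "\<eta> * 2 ^ k \<le> 1 - t" using k \<eta> by (simp_all add: field_simps)
      then show "\<exists>k. 1 - t \<le> \<eta> * 2 ^ Suc k \<and> (1 - t) powr (-\<sigma>) * indicator {..1-\<eta>} t \<le> (\<eta> * 2 ^ k) powr (-\<sigma>)"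
        using \<sigma> \<open>0 \<le> s\<close> \<eta> t' by (intro exI[of _ k]) (auto intro!: powr_mono2')
    qed (use C \<eta> in auto)
    then show ?thesis by (simp add: K_def mult_ac)
  qed
  have meas: "(\<lambda>t. (1 - t) powr (-\<sigma>) * indicator {..1-\<eta>} t) \<in> borel_measurable mu" for \<eta>
    by (rule measurable_mu_borel) measurable
  show ?thesis
  proof (rule that[OF K])
    fix \<eta> :: real assume \<eta>: "0 < \<eta>"
    show 1: "integrable mu (\<lambda>t. (1 - t) powr (-\<sigma>) * indicator {..1-\<eta>} t)"
    proof (rule integrableI_nonneg[OF meas])
      show "(\<integral>\<^sup>+t. ennreal ((1 - t) powr (-\<sigma>) * indicator {..1-\<eta>} t) \<partial>mu) < \<infinity>"
        using nn[OF \<eta>] by (rule le_less_trans) simp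
    qed auto
    show "(\<integral>t. (1 - t) powr (-\<sigma>) * indicator {..1-\<eta>} t \<partial>mu) \<le> K * \<eta> powr (s - \<sigma>)"
      using nn[OF \<eta>] K by (subst (asm) nn_integral_eq_integral[OF 1]) auto
  qed
qed

end

subsection \<open>Singular integrals on arcs\<close>

lemma norm_one_minus_cis: "norm (1 - cis x) = 2 * \<bar>sin (x/2)\<bar>"
  using dist_exp_i_1[of x] by (simp add: cis_conv_exp norm_minus_commute)

text \<open>Up to pi/3 the cosine is at least 1/2 and the mean value theorem applies. Beyond, sin y
  is at least sqrt 3 / 2, which exceeds 0.8, while y / 2 stays below 0.8.\<close>

lemma sin_ge_half: assumes "0 \<le> y" "y \<le> pi/2" shows "y / 2 \<le> sin y"
proof (cases "y \<le> pi/3")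
  case True
  show ?thesis
  proof (cases "y = 0")
    case False
    then have "0 < y" using assms by simp
    then obtain x where x: "0 < x" "x < y" "sin y - sin 0 = (y - 0) * cos x"
      using MVT2[of 0 y sin cos] by (auto intro: DERIV_sin)
    have "cos (pi/3) \<le> cos x" using x True by (intro cos_monotone_0_pi_le) auto
    then have "y * (1/2) \<le> y * cos x" using assms by (intro mult_left_mono) (auto simp: cos_60)
    with x show ?thesis by simp
  qed simp
next
  case False
  have "sin (pi/3) \<le> sin y" using False assms by (intro sin_monotone_2pi_le) auto
  moreover have "1.7 \<le> sqrt 3" by (rule real_le_rsqrt) (simp add: power2_eq_square)
  moreover have "y \<le> 1.6" using assms pi_less_4 pi_approx by simp
  ultimately show ?thesis by (simp add: sin_60)
qed

lemma norm_one_minus_cis_ge: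
  assumes "\<bar>x\<bar> \<le> pi" shows "\<bar>x\<bar> / 2 \<le> norm (1 - cis x)"
proof -
  have "\<bar>x\<bar> / 2 / 2 \<le> sin (\<bar>x\<bar> / 2)" using assms by (intro sin_ge_half) auto
  also have "sin (\<bar>x\<bar> / 2) \<le> \<bar>sin (x/2)\<bar>" by (cases "0 \<le> x") auto
  finally show ?thesis by (simp add: norm_one_minus_cis)
qed

text \<open>The constant is uniform in the position of the singularity c: at distance at least l the
  integrand is at most \<open>l powr (-\<beta>)\<close>, and within distance l it is dominated by
  two one-sided integrals over an interval of length l.\<close>

lemma nn_integral_powr_dist_interval_le:
  fixes a c l \<beta> :: real
  assumes \<beta>: "0 < \<beta>" "\<beta> < 1" and l: "0 < l"
  shows "(\<integral>\<^sup>+\<theta>\<in>{a..a+l}. ennreal (\<bar>\<theta> - c\<bar> powr (-\<beta>)) \<partial>lborel)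
    \<le> ennreal ((1 + 2 / (1 - \<beta>)) * l powr (1 - \<beta>))"
proof -
  define \<phi> where "\<phi> x = ennreal (x powr (-\<beta>)) * indicator {0..l} x" for x
  have [measurable]: "\<phi> \<in> borel_measurable borel" unfolding \<phi>_def by measurable
  define I where "I = l powr (1 - \<beta>) / (1 - \<beta>)"
  have I0: "0 \<le> I" using \<beta> by (simp add: I_def)
  have "((\<lambda>x. x powr (-\<beta>)) has_integral I) {0..l}"
    using has_integral_powr_from_0[of "-\<beta>" l] \<beta> l by (simp add: I_def)
  then have I: "(\<integral>\<^sup>+x. \<phi> x \<partial>lborel) = ennreal I"
    unfolding \<phi>_def by (intro nn_integral_Icc_eq_of_has_integral) auto
  have I1: "(\<integral>\<^sup>+x. \<phi> (x - c) \<partial>lborel) = ennreal I"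
    using nn_integral_real_affine[of \<phi> 1 "-c"] I by simp
  have I2: "(\<integral>\<^sup>+x. \<phi> (c - x) \<partial>lborel) = ennreal I"
    using nn_integral_real_affine[of \<phi> "-1" c] I by simp
  have "(\<integral>\<^sup>+\<theta>\<in>{a..a+l}. ennreal (\<bar>\<theta> - c\<bar> powr (-\<beta>)) \<partial>lborel)
      \<le> (\<integral>\<^sup>+\<theta>. ennreal (l powr (-\<beta>)) * indicator {a..a+l} \<theta> + (\<phi> (\<theta> - c) + \<phi> (c - \<theta>)) \<partial>lborel)"
  proof (rule nn_integral_mono)
    fix \<theta>
    consider "l \<le> \<bar>\<theta> - c\<bar>" | "0 \<le> \<theta> - c" "\<theta> - c \<le> l" | "0 \<le> c - \<theta>" "c - \<theta> \<le> l" by linarith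
    then show "ennreal (\<bar>\<theta> - c\<bar> powr (-\<beta>)) * indicator {a..a+l} \<theta>
        \<le> ennreal (l powr (-\<beta>)) * indicator {a..a+l} \<theta> + (\<phi> (\<theta> - c) + \<phi> (c - \<theta>))"
    proof cases
      case 1
      then have "\<bar>\<theta> - c\<bar> powr (-\<beta>) \<le> l powr (-\<beta>)" using l \<beta> by (intro powr_mono2') auto
      then have "ennreal (\<bar>\<theta> - c\<bar> powr (-\<beta>)) * indicator {a..a+l} \<theta>
        \<le> ennreal (l powr (-\<beta>)) * indicator {a..a+l} \<theta> + 0"
        by (auto simp: indicator_def intro: ennreal_leI)
      also have "\<dots> \<le> ennreal (l powr (-\<beta>)) * indicator {a..a+l} \<theta> + (\<phi> (\<theta> - c) + \<phi> (c - \<theta>))"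
        by (rule add_left_mono) simp
      finally show ?thesis .
    next
      case 2
      then have "ennreal (\<bar>\<theta> - c\<bar> powr (-\<beta>)) * indicator {a..a+l} \<theta> \<le> 0 + (\<phi> (\<theta> - c) + 0)"
        by (auto simp: \<phi>_def indicator_def)
      also have "\<dots> \<le> ennreal (l powr (-\<beta>)) * indicator {a..a+l} \<theta> + (\<phi> (\<theta> - c) + \<phi> (c - \<theta>))"
        by (intro add_mono) auto
      finally show ?thesis .
    next
      case 3
      then have "ennreal (\<bar>\<theta> - c\<bar> powr (-\<beta>)) * indicator {a..a+l} \<theta> \<le> 0 + (0 + \<phi> (c - \<theta>))"
        by (auto simp: \<phi>_def indicator_def)
      also have "\<dots> \<le> ennreal (l powr (-\<beta>)) * indicator {a..a+l} \<theta> + (\<phi> (\<theta> - c) + \<phi> (c - \<theta>))"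
        by (intro add_mono) auto
      finally show ?thesis .
    qed
  qed
  also have "\<dots> = ennreal (l powr (-\<beta>)) * ennreal l + 2 * ennreal I"
    using l by (simp add: nn_integral_add I1 I2 nn_integral_cmult_indicator mult_2)
  also have "\<dots> = ennreal (l powr (-\<beta>) * l + 2 * I)"
    using l I0 by (simp add: ennreal_mult')
  also have "l powr (-\<beta>) * l + 2 * I = (1 + 2 / (1 - \<beta>)) * l powr (1 - \<beta>)"
    using l powr_mult_base[of l "-\<beta>"] by (simp add: I_def algebra_simps)
  finally show ?thesis .
qed

text \<open>With 2 pi k the last zero of \<open>1 - cis\<close> not beyond a, the arc lies between 2
  pi k and 2 pi k + 4 pi. Each of its points is within pi of one of the three zeros in that range,
  near which the chord is comparable to the distance. This explains the factor 3.\<close>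

lemma nn_integral_norm_one_minus_cis_powr_le:
  fixes \<beta> :: real
  assumes \<beta>: "0 < \<beta>" "\<beta> < 1"
  obtains K where "0 \<le> K" "\<And>a l. 0 < l \<Longrightarrow> l \<le> 2 * pi \<Longrightarrow>
    (\<integral>\<^sup>+\<theta>\<in>{a..a+l}. ennreal (norm (1 - cis \<theta>) powr (-\<beta>)) \<partial>lborel) \<le> ennreal (K * l powr (1 - \<beta>))"
proof
  show "0 \<le> 3 * (2 powr \<beta> * (1 + 2 / (1 - \<beta>)))" using \<beta> by simp
  fix a l :: real assume l: "0 < l" "l \<le> 2 * pi"
  define k where "k = \<lfloor>a / (2*pi)\<rfloor>"
  have k: "2 * pi * k \<le> a" "a < 2 * pi * k + 2 * pi"
  proof -
    have "of_int k \<le> a / (2*pi)" "a / (2*pi) < of_int k + 1" unfolding k_def by linarith+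
    then show "2 * pi * k \<le> a" "a < 2 * pi * k + 2 * pi" by (simp_all add: field_simps)
  qed
  define c where "c j = 2 * pi * real_of_int (k + int j)" for j :: nat
  define \<psi> where "\<psi> j \<theta> = ennreal (2 powr \<beta>) * (ennreal (\<bar>\<theta> - c j\<bar> powr (-\<beta>)) * indicator {a..a+l} \<theta>)" for j \<theta>
  have near: "norm (1 - cis \<theta>) powr (-\<beta>) \<le> 2 powr \<beta> * \<bar>\<theta> - c j\<bar> powr (-\<beta>)" if "\<bar>\<theta> - c j\<bar> \<le> pi" for j \<theta>
  proof -
    have "cis (\<theta> - c j) = cis \<theta>"
      using cis_multiple_2pi[of "real_of_int (k + int j)"] by (simp add: c_def cis_divide[symmetric])
    then have ge: "\<bar>\<theta> - c j\<bar> / 2 \<le> norm (1 - cis \<theta>)" using norm_one_minus_cis_ge[OF that] by simp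
    show ?thesis
    proof (cases "\<theta> = c j")
      \<comment> \<open>At the singularity itself \<open>0 powr (-\<beta>)\<close> is 0 by
        convention.\<close>
      case True
      then have "cis \<theta> = 1" using \<open>cis (\<theta> - c j) = cis \<theta>\<close> by simp
      then show ?thesis by simp
    next
      case False
      then have "norm (1 - cis \<theta>) powr (-\<beta>) \<le> (\<bar>\<theta> - c j\<bar> / 2) powr (-\<beta>)"
        using ge \<beta> by (intro powr_mono2') auto
      then show ?thesis by (simp add: powr_divide powr_minus field_simps)
    qed
  qed
  have "(\<integral>\<^sup>+\<theta>\<in>{a..a+l}. ennreal (norm (1 - cis \<theta>) powr (-\<beta>)) \<partial>lborel)
     \<le> (\<integral>\<^sup>+\<theta>. (\<Sum>j<3. \<psi> j \<theta>) \<partial>lborel)"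
  proof (rule nn_integral_mono)
    fix \<theta>
    show "ennreal (norm (1 - cis \<theta>) powr (-\<beta>)) * indicator {a..a+l} \<theta> \<le> (\<Sum>j<3. \<psi> j \<theta>)"
    proof (cases "\<theta> \<in> {a..a+l}")
      case True
      then have "2 * pi * k \<le> \<theta>" "\<theta> \<le> 2 * pi * k + 4 * pi" using k l by auto
      then have "\<bar>\<theta> - c 0\<bar> \<le> pi \<or> \<bar>\<theta> - c 1\<bar> \<le> pi \<or> \<bar>\<theta> - c 2\<bar> \<le> pi"
        by (simp add: c_def algebra_simps) linarith
      then obtain j where j: "j < 3" "\<bar>\<theta> - c j\<bar> \<le> pi" by (metis numeral_3_eq_3 lessI less_SucI zero_less_Suc One_nat_def numeral_2_eq_2)
      have "ennreal (norm (1 - cis \<theta>) powr (-\<beta>)) * indicator {a..a+l} \<theta> \<le> \<psi> j \<theta>"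
        using near[OF j(2)] True by (simp add: \<psi>_def ennreal_leI flip: ennreal_mult')
      also have "\<dots> \<le> (\<Sum>j<3. \<psi> j \<theta>)" using j by (intro member_le_sum) auto
      finally show ?thesis .
    qed simp
  qed
  also have "\<dots> = (\<Sum>j<3. \<integral>\<^sup>+\<theta>. \<psi> j \<theta> \<partial>lborel)"
    by (rule nn_integral_sum) (simp add: \<psi>_def)
  also have "\<dots> \<le> (\<Sum>j<(3::nat). ennreal (2 powr \<beta>) * ennreal ((1 + 2 / (1 - \<beta>)) * l powr (1 - \<beta>)))"
    unfolding \<psi>_def
    using nn_integral_powr_dist_interval_le[OF \<beta> l(1)] by (intro sum_mono) (simp add: nn_integral_cmult mult_left_mono)
  also have "\<dots> = ennreal (3 * (2 powr \<beta> * (1 + 2 / (1 - \<beta>))) * l powr (1 - \<beta>))"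
    using \<beta> by (simp add: mult_ac flip: ennreal_mult' ennreal_numeral)
  finally show "(\<integral>\<^sup>+\<theta>\<in>{a..a+l}. ennreal (norm (1 - cis \<theta>) powr (-\<beta>)) \<partial>lborel)
    \<le> ennreal (3 * (2 powr \<beta> * (1 + 2 / (1 - \<beta>))) * l powr (1 - \<beta>))" .
qed

text \<open>Both \<open>1 - \<rho>\<close> and \<open>norm (1 - z) / 2\<close> are lower bounds,
  hence so is their geometric mean with weights \<open>1 - b\<close> and \<open>b\<close>. In this
  way the singularity of the kernel is shared between the radial variable and the angle.\<close>

lemma norm_one_minus_scaled_ge:
  fixes z :: complex
  assumes z: "norm z = 1" and \<rho>: "0 \<le> \<rho>" "\<rho> < 1" and b: "0 \<le> b" "b \<le> 1"
  shows "(1 - \<rho>) powr (1 - b) * (norm (1 - z) / 2) powr b \<le> norm (1 - of_real \<rho> * z)"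
proof -
  let ?n = "norm (1 - of_real \<rho> * z)"
  have 1: "1 - \<rho> \<le> ?n"
    using norm_triangle_ineq2[of 1 "of_real \<rho> * z"] z \<rho> by (simp add: norm_mult)
  have "norm (1 - z) \<le> ?n + norm (of_real \<rho> * z - z)"
    using norm_triangle_ineq[of "1 - of_real \<rho> * z" "of_real \<rho> * z - z"] by simp
  also have "of_real \<rho> * z - z = of_real (\<rho> - 1) * z" by (simp add: algebra_simps)
  also have "norm \<dots> = 1 - \<rho>" using z \<rho> by (simp only: norm_mult norm_of_real) simp
  finally have 2: "norm (1 - z) / 2 \<le> ?n" using 1 by simp
  have "(1 - \<rho>) powr (1 - b) * (norm (1 - z) / 2) powr b \<le> ?n powr (1 - b) * ?n powr b"
    using 1 2 \<rho> b by (intro mult_mono powr_mono2) auto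
  also have "\<dots> = ?n" using 1 \<rho> by (simp flip: powr_add)
  finally show ?thesis .
qed

subsection \<open>Boundary values of the operator\<close>

lemma continuous_on_radius_of_holomorphic:
  fixes g :: "complex \<Rightarrow> complex"
  assumes "g holomorphic_on ball 0 1" "norm z \<le> 1"
  shows "continuous_on {0..<1} (\<lambda>t::real. g (of_real t * z))"
proof (rule continuous_on_compose2[OF holomorphic_on_imp_continuous_on[OF assms(1)]])
  have "\<bar>t\<bar> * norm z < 1" if "0 \<le> t" "t < 1" for t
    using that assms(2) mult_mono[of t t "norm z" 1] by simp
  then show "(\<lambda>t::real. of_real t * z) ` {0..<1} \<subseteq> ball 0 1" by (auto simp: norm_mult)
qed (intro continuous_intros)

lemma holomorphic_cesaro_kernel:
  assumes "f holomorphic_on ball 0 1" shows "(\<lambda>w::complex. f w / (1 - w)) holomorphic_on ball 0 1"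
  using assms by (intro holomorphic_intros) auto

context finite_measure_unit_interval
begin

text \<open>The power series of f(w) / (1 - w) is integrated term by term, which multiplies its n-th
  coefficient by the n-th moment of \<open>mu\<close>. Since t is at most 1, the terms are dominated
  by those at z, where the series converges absolutely.\<close>

lemma holomorphic_cesaro_like:
  assumes holf: "f holomorphic_on ball 0 1"
  shows "cesaro_like mu f holomorphic_on ball 0 1"
proof -
  define g where "g w = f w / (1 - w)" for w
  have holg: "g holomorphic_on ball 0 1"
    unfolding g_def by (rule holomorphic_cesaro_kernel[OF holf])
  define c where "c n = (deriv ^^ n) g 0 / fact n" for n
  have sums: "(\<lambda>n. c n * w ^ n) sums g w" if "norm w < 1" for w
    using holomorphic_power_series[OF holg, of w] that by (simp add: c_def)
  have "(\<lambda>n. (c n * of_real (\<integral>t. t ^ n \<partial>mu)) * (z - 0) ^ n) sums cesaro_like mu f z" if "z \<in> ball 0 1" for z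
  proof -
    from that have z: "norm z < 1" by simp
    then obtain R where R: "norm z < R" "R < 1" using dense by blast
    have R0: "0 \<le> R" using R norm_ge_zero[of z] by linarith
    have abs: "summable (\<lambda>n. norm (c n * z ^ n))"
      by (rule powser_insidea[of _ "of_real R"]) (use R R0 sums[of "of_real R"] in \<open>auto dest: sums_summable\<close>)
    define h where "h n t = c n * (of_real t * z) ^ n" for n and t :: real
    have le: "norm (h n t) \<le> norm (c n * z ^ n)" if "t \<in> space mu" for n t
    proof -
      have "t ^ n \<le> 1" using that by (intro power_le_one) (auto simp: space_mu)
      then have "norm (c n * z ^ n) * t ^ n \<le> norm (c n * z ^ n) * 1" by (intro mult_left_mono) auto
      then show ?thesis using that by (simp add: h_def space_mu norm_mult norm_power power_mult_distrib mult_ac)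
    qed
    have int: "integrable mu (h n)" for n
    proof (rule integrable_const_bound)
      show "h n \<in> borel_measurable mu"
        unfolding h_def by (intro measurable_mu_continuous continuous_intros)
    qed (use le in auto)
    have "(\<lambda>n. integral\<^sup>L mu (h n)) sums (\<integral>t. (\<Sum>n. h n t) \<partial>mu)"
    proof (rule sums_integral[OF int])
      show "AE t in mu. summable (\<lambda>n. norm (h n t))"
        using le by (intro AE_I2 summable_comparison_test'[OF abs]) auto
      have "(\<integral>t. norm (h n t) \<partial>mu) \<le> (\<integral>t. norm (c n * z ^ n) \<partial>mu)" for n
        using le int by (intro integral_mono) auto
      then show "summable (\<lambda>n. \<integral>t. norm (h n t) \<partial>mu)"
        by (intro summable_comparison_test'[OF summable_mult[OF abs, of "measure mu (space mu)"]]) auto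
    qed
    also have "(\<integral>t. (\<Sum>n. h n t) \<partial>mu) = (\<integral>t. g (of_real t * z) \<partial>mu)"
    proof (rule Bochner_Integration.integral_cong[OF refl])
      fix t assume "t \<in> space mu"
      then have "norm (of_real t * z) < 1"
        using z mult_mono[of t 1 "norm z" "norm z"] by (auto simp: norm_mult space_mu)
      then show "(\<Sum>n. h n t) = g (of_real t * z)"
        unfolding h_def using sums by (metis sums_unique)
    qed
    also have "\<dots> = cesaro_like mu f z" using z by (simp add: cesaro_like_def unit_disc_def g_def)
    also have "(\<lambda>n. integral\<^sup>L mu (h n)) = (\<lambda>n. (c n * of_real (\<integral>t. t ^ n \<partial>mu)) * (z - 0) ^ n)"
    proof
      fix n
      have "integral\<^sup>L mu (h n) = (\<integral>t. (c n * z ^ n) * of_real (t ^ n) \<partial>mu)"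
        by (rule Bochner_Integration.integral_cong) (simp_all add: h_def power_mult_distrib mult_ac)
      then show "integral\<^sup>L mu (h n) = (c n * of_real (\<integral>t. t ^ n \<partial>mu)) * (z - 0) ^ n"
        by (simp only: integral_mult_right_zero integral_complex_of_real) simp
    qed
    finally show ?thesis .
  qed
  then show ?thesis by (rule power_series_holomorphic)
qed

end

text \<open>Here \<open>e\<close> stands for 1/p, with e = 0 for bounded functions.\<close>

locale cesaro_growth = finite_measure_unit_interval +
  fixes f :: "complex \<Rightarrow> complex" and C e lam :: real
  assumes holf: "f holomorphic_on ball 0 1" and C0: "0 \<le> C" and e0: "0 \<le> e"
    and growth: "\<And>z. norm z < 1 \<Longrightarrow> norm (f z) \<le> C * (1 - norm z) powr (-e)"
    and lam: "0 < lam" "lam \<le> 1"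
    and carl: "carleson mu ((1 + lam) / 2 + e)"
begin

abbreviation g :: "complex \<Rightarrow> complex" where "g w \<equiv> f w / (1 - w)"

text \<open>Any exponent strictly between \<open>(1 - lam) / 2\<close> and \<open>1 / 2\<close> would do: the lower bound makes
  \<open>(1 - t) powr (b - 1 - e)\<close> integrable, the upper one makes \<open>norm (1 - cis \<theta>) powr (- b)\<close>
  square integrable.\<close>
definition b :: real where "b = 1/2 - lam/4"

lemma b: "0 < b" "b < 1/2" "(1 - lam) / 2 < b"
  using lam by (auto simp: b_def field_simps)

lemma growth_le:
  assumes "norm w \<le> t" "t < 1" shows "norm (f w) \<le> C * (1 - t) powr (-e)"
proof -
  have "norm (f w) \<le> C * (1 - norm w) powr (-e)" using assms by (intro growth) auto
  also have "\<dots> \<le> C * (1 - t) powr (-e)"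
    using assms e0 C0 by (intro mult_left_mono powr_mono2') auto
  finally show ?thesis .
qed

text \<open>The majorant does not depend on r, and r = 1 is included. It can therefore serve for the
  boundary integrand, for dominated convergence along radii and for the uniform quadratic
  means.\<close>

lemma kernel_bound:
  assumes t: "0 \<le> t" "t < 1" and r: "0 \<le> r" "r \<le> 1" and th: "cis \<theta> \<noteq> 1"
  shows "norm (g (of_real t * (of_real r * cis \<theta>)))
    \<le> C * 2 powr b * norm (1 - cis \<theta>) powr (-b) * (1 - t) powr (-(e + 1 - b))"
proof -
  have rt: "r * t \<le> t" "0 \<le> r * t" using t r mult_right_mono[of r 1 t] by auto
  have n0: "0 < norm (1 - cis \<theta>)" using th by simp
  have "(1 - t) powr (1 - b) * (norm (1 - cis \<theta>) / 2) powr b \<le> (1 - r * t) powr (1 - b) * (norm (1 - cis \<theta>) / 2) powr b"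
    using t rt b by (intro mult_right_mono powr_mono2) auto
  also have "\<dots> \<le> norm (1 - of_real (r * t) * cis \<theta>)"
    by (rule norm_one_minus_scaled_ge) (use t rt b in auto)
  finally have 1: "(1 - t) powr (1 - b) * (norm (1 - cis \<theta>) / 2) powr b \<le> norm (1 - of_real t * (of_real r * cis \<theta>))"
    by (simp add: mult_ac)
  have 2: "norm (f (of_real t * (of_real r * cis \<theta>))) \<le> C * (1 - t) powr (-e)"
    by (rule growth_le) (use t r rt in \<open>auto simp: norm_mult mult_ac\<close>)
  have "norm (g (of_real t * (of_real r * cis \<theta>)))
    \<le> (C * (1 - t) powr (-e)) / ((1 - t) powr (1 - b) * (norm (1 - cis \<theta>) / 2) powr b)"
    unfolding norm_divide by (rule frac_le) (use 1 2 C0 t n0 in auto)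
  also have "\<dots> = C * 2 powr b * norm (1 - cis \<theta>) powr (-b) * ((1 - t) powr (-e) / (1 - t) powr (1 - b))"
    using t n0 by (simp add: powr_divide powr_minus field_simps)
  also have "(1 - t) powr (-e) / (1 - t) powr (1 - b) = (1 - t) powr (-(e + 1 - b))"
    by (simp add: powr_diff[symmetric] algebra_simps)
  finally show ?thesis .
qed

text \<open>The lower bound \<open>(1 - lam) / 2 < b\<close> says precisely that
  \<open>e + 1 - b\<close> is below the Carleson exponent. With \<open>\<eta> = 1\<close> the
  indicator is 1 on the whole interval.\<close>

lemma integrable_weight: "integrable mu (\<lambda>t. (1 - t) powr (-(e + 1 - b)))"
proof -
  have "0 \<le> e + 1 - b" "e + 1 - b < (1 + lam) / 2 + e" using e0 b by (auto simp: field_simps)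
  from carleson_integral_near[OF carl this]
  have "integrable mu (\<lambda>t. (1 - t) powr (-(e + 1 - b)) * indicator {1-1..} t)"
    by (metis zero_less_one)
  then show ?thesis
    by (rule Bochner_Integration.integrable_cong[THEN iffD1, rotated -1]) (auto simp: space_mu)
qed

lemma measurable_kernel:
  assumes "norm z \<le> 1" shows "(\<lambda>t. g (of_real t * z)) \<in> borel_measurable mu"
  by (intro measurable_mu_continuous continuous_on_radius_of_holomorphic[OF holomorphic_cesaro_kernel[OF holf]] assms)

lemma integrable_kernel:
  assumes r: "0 \<le> r" "r \<le> 1" and th: "cis \<theta> \<noteq> 1"
  shows "integrable mu (\<lambda>t. g (of_real t * (of_real r * cis \<theta>)))"
  by (rule Bochner_Integration.integrable_bound[OF
        integrable_mult_right[OF integrable_weight, of "C * 2 powr b * norm (1 - cis \<theta>) powr (-b)"]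
        measurable_kernel])
     (use kernel_bound[OF _ _ r th] C0 r in \<open>auto intro!: AE_I2 simp: space_mu norm_mult\<close>)

lemma cesaro_eq: "norm z < 1 \<Longrightarrow> cesaro_like mu f z = (\<integral>t. g (of_real t * z) \<partial>mu)"
  by (simp add: cesaro_like_def unit_disc_def)

text \<open>Dominated convergence with the majorant of \<open>kernel_bound\<close>. The radial limit
  exists at every boundary point other than 1, and not merely almost everywhere.\<close>

lemma tendsto_bdry:
  assumes th: "cis \<theta> \<noteq> 1"
  shows "((\<lambda>r::real. cesaro_like mu f (of_real r * cis \<theta>)) \<longlongrightarrow> (\<integral>t. g (of_real t * cis \<theta>) \<partial>mu)) (at_left 1)"
proof (rule tendsto_at_left_sequentially[of 0])
  fix S :: "nat \<Rightarrow> real" assume S: "\<And>n. S n < 1" "\<And>n. 0 < S n" "S \<longlonglongrightarrow> 1"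
  have [simp]: "norm (of_real (S n) * cis \<theta>) < 1" for n
    using S(1)[of n] S(2)[of n] by (simp add: norm_mult)
  have "(\<lambda>n. \<integral>t. g (of_real t * (of_real (S n) * cis \<theta>)) \<partial>mu) \<longlonglongrightarrow> (\<integral>t. g (of_real t * cis \<theta>) \<partial>mu)"
  proof (rule integral_dominated_convergence)
    show "integrable mu (\<lambda>t. C * 2 powr b * norm (1 - cis \<theta>) powr (-b) * (1 - t) powr (-(e + 1 - b)))"
      by (rule integrable_mult_right[OF integrable_weight])
    show "AE t in mu. (\<lambda>n. g (of_real t * (of_real (S n) * cis \<theta>))) \<longlonglongrightarrow> g (of_real t * cis \<theta>)"
    proof (rule AE_I2)
      fix t assume t: "t \<in> space mu"
      have "isCont g (of_real t * cis \<theta>)"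
        using holomorphic_on_imp_continuous_on[OF holomorphic_cesaro_kernel[OF holf]] t
        by (subst (asm) continuous_on_eq_continuous_at) (auto simp: space_mu norm_mult)
      moreover have "(\<lambda>n. of_real t * (of_real (S n) * cis \<theta>)) \<longlonglongrightarrow> of_real t * (of_real 1 * cis \<theta>)"
        by (intro tendsto_intros S)
      ultimately show "(\<lambda>n. g (of_real t * (of_real (S n) * cis \<theta>))) \<longlonglongrightarrow> g (of_real t * cis \<theta>)"
        using isCont_tendsto_compose[of "of_real t * cis \<theta>" g] by simp
    qed
    show "AE t in mu. norm (g (of_real t * (of_real (S n) * cis \<theta>)))
       \<le> C * 2 powr b * norm (1 - cis \<theta>) powr (-b) * (1 - t) powr (-(e + 1 - b))" for n
      using S(1,2)[of n] th by (intro AE_I2 kernel_bound) (auto simp: space_mu)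
  next
    show "(\<lambda>t. g (of_real t * (of_real (S n) * cis \<theta>))) \<in> borel_measurable mu" for n
      by (rule measurable_kernel) (rule less_imp_le, simp)
  qed (auto intro!: measurable_kernel)
  then show "(\<lambda>n. cesaro_like mu f (of_real (S n) * cis \<theta>)) \<longlonglongrightarrow> (\<integral>t. g (of_real t * cis \<theta>) \<partial>mu)"
    by (simp add: cesaro_eq)
qed simp

lemma bdry_eq: "cis \<theta> \<noteq> 1 \<Longrightarrow> bdry (cesaro_like mu f) \<theta> = (\<integral>t. g (of_real t * cis \<theta>) \<partial>mu)"
  unfolding bdry_def by (intro tendsto_Lim tendsto_bdry) auto

lemma measurable_bdry: "bdry (cesaro_like mu f) \<in> borel_measurable borel"
proof -
  let ?r = "\<lambda>n. 1 - inverse (real (Suc n))"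
  \<comment> \<open>At the point 1 no radial limit is claimed and \<open>Lim\<close> may be an
    arbitrary value. It is the same value for all angles with \<open>cis \<theta> = 1\<close>, so
    the approximants are set to it there and converge everywhere.\<close>
  let ?u = "\<lambda>n \<theta>. if cis \<theta> = 1 then bdry (cesaro_like mu f) 0 else cesaro_like mu f (of_real (?r n) * cis \<theta>)"
  have r: "0 \<le> ?r n" "?r n < 1" for n by (auto simp: field_simps)
  have rlim: "?r \<longlonglongrightarrow> 1" using tendsto_diff[OF tendsto_const LIMSEQ_inverse_real_of_nat, of 1] by simp
  show ?thesis
  proof (rule borel_measurable_LIMSEQ_metric[of ?u])
    fix n
    have "continuous_on UNIV (\<lambda>\<theta>. cesaro_like mu f (of_real (?r n) * cis \<theta>))"
    proof (rule continuous_on_compose2[OF holomorphic_on_imp_continuous_on[OF holomorphic_cesaro_like[OF holf]]])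
      show "range (\<lambda>\<theta>. of_real (?r n) * cis \<theta>) \<subseteq> ball 0 1"
        using r[of n] by (auto simp: norm_mult simp del: of_real_diff of_real_inverse)
    qed (intro continuous_intros)
    then have [measurable]: "(\<lambda>\<theta>. cesaro_like mu f (of_real (?r n) * cis \<theta>)) \<in> borel_measurable borel"
      by (rule borel_measurable_continuous_onI)
    show "?u n \<in> borel_measurable borel" by measurable
  next
    fix \<theta> :: real
    show "(\<lambda>n. ?u n \<theta>) \<longlonglongrightarrow> bdry (cesaro_like mu f) \<theta>"
    proof (cases "cis \<theta> = 1")
      case True
      then show ?thesis by (simp add: bdry_def)
    next
      case False
      have "filterlim ?r (at_left 1) sequentially"
        using rlim r by (auto simp: filterlim_at intro!: always_eventually)
      then have "(\<lambda>n. cesaro_like mu f (of_real (?r n) * cis \<theta>)) \<longlonglongrightarrow> (\<integral>t. g (of_real t * cis \<theta>) \<partial>mu)"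
        by (rule filterlim_compose[OF tendsto_bdry[OF False]])
      then show ?thesis using False by (simp add: bdry_eq)
    qed
  qed
qed

end

subsection \<open>Morrey estimate\<close>

lemma AE_cis_neq_1: "AE \<theta> in lborel. cis \<theta> \<noteq> 1"
proof -
  have "{\<theta>. cis \<theta> = 1} \<subseteq> range (\<lambda>n::int. of_int n * (2 * pi))"
    by (auto simp: complex_eq_iff cos_one_2pi_int)
  then have "countable {\<theta>. cis \<theta> = 1}" by (rule countable_subset) auto
  then have "{\<theta>. cis \<theta> = 1} \<in> null_sets lborel" by (rule countable_imp_null_set_lborel)
  then show ?thesis by (auto dest: AE_not_in)
qed

lemma norm_cis_diff_le: "norm (cis x - cis y) \<le> \<bar>x - y\<bar>"
proof -
  have "cis x - cis y = cis y * (cis (x - y) - 1)"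
    by (simp add: cis_divide[symmetric] field_simps)
  then have "norm (cis x - cis y) = norm (1 - cis (x - y))" by (simp add: norm_mult norm_minus_commute)
  also have "\<dots> \<le> \<bar>x - y\<bar>"
    using abs_sin_x_le_abs_x[of "(x - y) / 2"] by (simp add: norm_one_minus_cis)
  finally show ?thesis .
qed

text \<open>On an arc of length \<open>l\<close> the bound is of size \<open>l powr \<tau>\<close> both on average and in quadratic mean,
  because \<open>b < 1/2\<close>.\<close>
lemma arc_oscillation_le:
  fixes u :: "real \<Rightarrow> complex"
  assumes u [measurable]: "u \<in> borel_measurable borel" and b: "0 < b" "b < 1/2" and AB: "0 \<le> A" "0 \<le> B"
    and osc: "\<And>a l. 0 < l \<Longrightarrow> l \<le> 2 * pi \<Longrightarrow> \<exists>c. \<forall>\<theta>\<in>{a..a+l}. cis \<theta> \<noteq> 1 \<longrightarrow>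
      norm (u \<theta> - c) \<le> A * l powr (\<tau> + b) * norm (1 - cis \<theta>) powr (-b) + B * l powr \<tau>"
  obtains M where "\<And>a l. 0 < l \<Longrightarrow> l \<le> 2 * pi \<Longrightarrow>
     (\<integral>\<^sup>+\<theta>\<in>{a..a+l}. ennreal ((norm (u \<theta> - 1 / of_real l * (\<integral>\<theta>\<in>{a..a+l}. u \<theta> \<partial>lborel)))\<^sup>2) \<partial>lborel)
       \<le> ennreal (M * l powr (2 * \<tau> + 1))"
proof -
  obtain K1 where K1: "0 \<le> K1" "\<And>a l. 0 < l \<Longrightarrow> l \<le> 2 * pi \<Longrightarrow>
    (\<integral>\<^sup>+\<theta>\<in>{a..a+l}. ennreal (norm (1 - cis \<theta>) powr (-b)) \<partial>lborel) \<le> ennreal (K1 * l powr (1 - b))"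
    using nn_integral_norm_one_minus_cis_powr_le[of b] b by auto
  obtain K2 where K2: "0 \<le> K2" "\<And>a l. 0 < l \<Longrightarrow> l \<le> 2 * pi \<Longrightarrow>
    (\<integral>\<^sup>+\<theta>\<in>{a..a+l}. ennreal (norm (1 - cis \<theta>) powr (-(2*b))) \<partial>lborel) \<le> ennreal (K2 * l powr (1 - 2*b))"
    using nn_integral_norm_one_minus_cis_powr_le[of "2*b"] b by auto
  have int_aff: "(\<integral>\<^sup>+\<theta>\<in>{a..a+l}. ennreal (P * norm (1 - cis \<theta>) powr (-x) + Q) \<partial>lborel)
      \<le> ennreal (P * (K * l powr (1 - x)) + Q * l)"
    if "0 \<le> P" "0 \<le> Q" "0 \<le> K" "0 < l"
      "(\<integral>\<^sup>+\<theta>\<in>{a..a+l}. ennreal (norm (1 - cis \<theta>) powr (-x)) \<partial>lborel) \<le> ennreal (K * l powr (1 - x))"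
    for P Q K x a l :: real
  proof -
    have "(\<integral>\<^sup>+\<theta>\<in>{a..a+l}. ennreal (P * norm (1 - cis \<theta>) powr (-x) + Q) \<partial>lborel)
      = (\<integral>\<^sup>+\<theta>. ennreal P * (ennreal (norm (1 - cis \<theta>) powr (-x)) * indicator {a..a+l} \<theta>) + ennreal Q * indicator {a..a+l} \<theta> \<partial>lborel)"
      using that by (intro nn_integral_cong) (simp add: ennreal_mult' indicator_def)
    also have "\<dots> = ennreal P * (\<integral>\<^sup>+\<theta>\<in>{a..a+l}. ennreal (norm (1 - cis \<theta>) powr (-x)) \<partial>lborel) + ennreal Q * ennreal l"
      using that by (simp add: nn_integral_add nn_integral_cmult nn_integral_cmult_indicator)
    also have "\<dots> \<le> ennreal P * ennreal (K * l powr (1 - x)) + ennreal Q * ennreal l"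
      using that by (intro add_mono mult_left_mono) auto
    also have "\<dots> = ennreal (P * (K * l powr (1 - x)) + Q * l)"
      using that by (simp add: ennreal_mult')
    finally show ?thesis .
  qed
  define D where "D = A * K1 + B"
  have D0: "0 \<le> D" using AB K1 by (simp add: D_def)
  define M where "M = 2 * A\<^sup>2 * K2 + 2 * (B + D)\<^sup>2"
  show ?thesis
  proof (rule that[of M])
    fix a l :: real assume l: "0 < l" "l \<le> 2 * pi"
    define I where "I = {a..a+l}"
    have [measurable]: "I \<in> sets borel" by (simp add: I_def)
    define n where "n \<theta> = norm (1 - cis \<theta>)" for \<theta>
    have [measurable]: "n \<in> borel_measurable borel" unfolding n_def by measurable
    obtain c where c: "\<And>\<theta>. \<theta> \<in> I \<Longrightarrow> cis \<theta> \<noteq> 1 \<Longrightarrow> norm (u \<theta> - c) \<le> A * l powr (\<tau> + b) * n \<theta> powr (-b) + B * l powr \<tau>"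
      using osc[OF l, of a] unfolding I_def n_def by blast
    have AEI: "AE \<theta> in lborel. \<theta> \<in> I \<longrightarrow> norm (u \<theta> - c) \<le> A * l powr (\<tau> + b) * n \<theta> powr (-b) + B * l powr \<tau>"
      using AE_cis_neq_1 c by (auto elim: eventually_mono)
    have nn: "(\<integral>\<^sup>+\<theta>. ennreal (norm (indicator I \<theta> *\<^sub>R (u \<theta> - c))) \<partial>lborel) \<le> ennreal (D * l powr (\<tau> + 1))"
    proof -
      have "(\<integral>\<^sup>+\<theta>. ennreal (norm (indicator I \<theta> *\<^sub>R (u \<theta> - c))) \<partial>lborel)
        \<le> (\<integral>\<^sup>+\<theta>\<in>{a..a+l}. ennreal (A * l powr (\<tau> + b) * norm (1 - cis \<theta>) powr (-b) + B * l powr \<tau>) \<partial>lborel)"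
        using AEI by (intro nn_integral_mono_AE) (auto elim!: eventually_mono simp: indicator_def I_def n_def intro!: ennreal_leI)
      also have "\<dots> \<le> ennreal (A * l powr (\<tau> + b) * (K1 * l powr (1 - b)) + B * l powr \<tau> * l)"
        using AB K1 l by (intro int_aff) auto
      also have "A * l powr (\<tau> + b) * (K1 * l powr (1 - b)) + B * l powr \<tau> * l
         = A * K1 * (l powr (\<tau> + b) * l powr (1 - b)) + B * (l powr \<tau> * l powr 1)" using l by simp
      also have "\<dots> = D * l powr (\<tau> + 1)" by (simp only: D_def flip: powr_add) (simp add: algebra_simps)
      finally show ?thesis .
    qed
    \<comment> \<open>The Bochner integral in the mean would be 0 by default for a nonintegrable
      function; the bound just shown excludes this.\<close>
    have int: "integrable lborel (\<lambda>\<theta>. indicator I \<theta> *\<^sub>R (u \<theta> - c))"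
      by (rule integrableI_bounded) (use nn in \<open>auto intro: le_less_trans\<close>)
    have intc: "integrable lborel (\<lambda>\<theta>. indicator I \<theta> *\<^sub>R c)"
      by (rule integrable_scaleR_left) (use l in \<open>auto simp: I_def intro!: integrable_real_indicator\<close>)
    \<comment> \<open>The hypothesis compares u with some constant c, the conclusion compares it
      with its mean m. As m - c is the mean of u - c, passing from c to m costs only a further
      multiple of \<open>l powr \<tau>\<close>.\<close>
    define m where "m = 1 / of_real l * (\<integral>\<theta>\<in>I. u \<theta> \<partial>lborel)"
    have Ic: "(\<integral>\<theta>. indicator I \<theta> *\<^sub>R c \<partial>lborel) = of_real l * c"
      using l by (simp add: I_def scaleR_conv_of_real)
    have "(\<integral>\<theta>\<in>I. u \<theta> \<partial>lborel) = (\<integral>\<theta>. indicator I \<theta> *\<^sub>R (u \<theta> - c) + indicator I \<theta> *\<^sub>R c \<partial>lborel)"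
      unfolding set_lebesgue_integral_def by (simp flip: scaleR_add_right)
    then have "(\<integral>\<theta>\<in>I. u \<theta> \<partial>lborel) = (\<integral>\<theta>. indicator I \<theta> *\<^sub>R (u \<theta> - c) \<partial>lborel) + of_real l * c"
      unfolding Bochner_Integration.integral_add[OF int intc] Ic .
    then have "m - c = 1 / of_real l * (\<integral>\<theta>. indicator I \<theta> *\<^sub>R (u \<theta> - c) \<partial>lborel)"
      using l by (simp add: m_def field_simps)
    then have "norm (m - c) = norm (\<integral>\<theta>. indicator I \<theta> *\<^sub>R (u \<theta> - c) \<partial>lborel) / l"
      using l by (simp add: norm_mult norm_divide)
    also have "\<dots> \<le> D * l powr (\<tau> + 1) / l"
    proof (rule divide_right_mono)
      have "ennreal (norm (\<integral>\<theta>. indicator I \<theta> *\<^sub>R (u \<theta> - c) \<partial>lborel)) \<le> ennreal (D * l powr (\<tau> + 1))"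
        using integral_norm_bound_ennreal[OF int] nn by (rule order_trans)
      then show "norm (\<integral>\<theta>. indicator I \<theta> *\<^sub>R (u \<theta> - c) \<partial>lborel) \<le> D * l powr (\<tau> + 1)"
        using D0 by (subst (asm) ennreal_le_iff) auto
    qed (use l in auto)
    also have "\<dots> = D * l powr \<tau>" using l by (simp add: powr_add)
    finally have mc: "norm (m - c) \<le> D * l powr \<tau>" .
    have sq: "(norm (u \<theta> - m))\<^sup>2 \<le> 2 * A\<^sup>2 * l powr (2 * \<tau> + 2 * b) * norm (1 - cis \<theta>) powr (-(2*b)) + 2 * (B + D)\<^sup>2 * l powr (2 * \<tau>)"
      if "norm (u \<theta> - c) \<le> A * l powr (\<tau> + b) * n \<theta> powr (-b) + B * l powr \<tau>" for \<theta>
    proof -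
      have sq2: "(x + y)\<^sup>2 \<le> 2 * x\<^sup>2 + 2 * y\<^sup>2" for x y :: real
        using sum_squares_bound[of x y] by (simp add: power2_sum)
      have p2: "(x powr y)\<^sup>2 = x powr (2 * y)" for x y :: real
        by (simp add: power2_eq_square flip: powr_add)
      have "norm (u \<theta> - m) \<le> norm (u \<theta> - c) + norm (m - c)"
        using norm_triangle_ineq4[of "u \<theta> - c" "m - c"] by simp
      also have "\<dots> \<le> A * l powr (\<tau> + b) * n \<theta> powr (-b) + (B + D) * l powr \<tau>"
        using that mc by (simp add: algebra_simps)
      finally have "(norm (u \<theta> - m))\<^sup>2 \<le> (A * l powr (\<tau> + b) * n \<theta> powr (-b) + (B + D) * l powr \<tau>)\<^sup>2"
        by (intro power_mono) auto
      also have "\<dots> \<le> 2 * (A * l powr (\<tau> + b) * n \<theta> powr (-b))\<^sup>2 + 2 * ((B + D) * l powr \<tau>)\<^sup>2"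
        by (rule sq2)
      also have "\<dots> = 2 * A\<^sup>2 * l powr (2 * \<tau> + 2 * b) * n \<theta> powr (-(2*b)) + 2 * (B + D)\<^sup>2 * l powr (2 * \<tau>)"
        by (simp add: power_mult_distrib p2 distrib_left)
      finally show ?thesis by (simp add: n_def)
    qed
    have "(\<integral>\<^sup>+\<theta>\<in>I. ennreal ((norm (u \<theta> - m))\<^sup>2) \<partial>lborel)
       \<le> (\<integral>\<^sup>+\<theta>\<in>{a..a+l}. ennreal (2 * A\<^sup>2 * l powr (2 * \<tau> + 2 * b) * norm (1 - cis \<theta>) powr (-(2*b)) + 2 * (B + D)\<^sup>2 * l powr (2 * \<tau>)) \<partial>lborel)"
      using AEI sq by (intro nn_integral_mono_AE)
        (auto elim!: eventually_mono simp: indicator_def I_def simp del: ennreal_plus intro!: ennreal_leI)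
    also have "\<dots> \<le> ennreal (2 * A\<^sup>2 * l powr (2 * \<tau> + 2 * b) * (K2 * l powr (1 - 2*b)) + 2 * (B + D)\<^sup>2 * l powr (2 * \<tau>) * l)"
      using AB D0 K2 l by (intro int_aff) auto
    also have "2 * A\<^sup>2 * l powr (2 * \<tau> + 2 * b) * (K2 * l powr (1 - 2*b)) + 2 * (B + D)\<^sup>2 * l powr (2 * \<tau>) * l
       = 2 * A\<^sup>2 * K2 * (l powr (2 * \<tau> + 2 * b) * l powr (1 - 2*b)) + 2 * (B + D)\<^sup>2 * (l powr (2 * \<tau>) * l powr 1)"
      using l by simp
    also have "\<dots> = M * l powr (2 * \<tau> + 1)" by (simp only: M_def flip: powr_add) (simp add: algebra_simps)
    finally show "(\<integral>\<^sup>+\<theta>\<in>{a..a+l}. ennreal ((norm (u \<theta> - 1 / of_real l * (\<integral>\<theta>\<in>{a..a+l}. u \<theta> \<partial>lborel)))\<^sup>2) \<partial>lborel)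
       \<le> ennreal (M * l powr (2 * \<tau> + 1))" by (simp add: I_def m_def)
  qed
qed

context cesaro_growth
begin

text \<open>On a disc of radius d = (1 - t) / 2 about a point of \<open>cball 0 t\<close>, both 1 -
  |x| and |1 - x| are at least d. Hence |g| is at most \<open>C * d powr (-e) / d\<close> there, and
  Cauchy's estimate for the derivative costs one more factor 1/d. The mean value inequality on the
  convex disc \<open>cball 0 t\<close> concludes.\<close>

lemma kernel_diff_le:
  assumes t: "0 \<le> t" "t < 1" and w: "norm w1 \<le> t" "norm w2 \<le> t"
  shows "norm (g w1 - g w2) \<le> C * 2 powr (e + 2) * (1 - t) powr (-(e + 2)) * norm (w1 - w2)"
proof -
  have holg: "g holomorphic_on ball 0 1" by (rule holomorphic_cesaro_kernel[OF holf])
  define d where "d = (1 - t) / 2"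
  have d: "0 < d" "t + d < 1" "1 - (t + d) = d" using t by (auto simp: d_def field_simps)
  define D where "D = C * d powr (-e) / d / d"
  have D: "D = C * 2 powr (e + 2) * (1 - t) powr (-(e + 2))"
  proof -
    have "D = C * (d powr (-e) / d powr 2)" using d by (simp add: D_def power2_eq_square)
    also have "\<dots> = C * d powr (-(e + 2))" by (simp add: powr_diff[symmetric])
    also have "d powr (-(e + 2)) = 2 powr (e + 2) * (1 - t) powr (-(e + 2))"
      using t unfolding d_def by (simp only: powr_divide powr_minus) (simp add: field_simps)
    finally show ?thesis by simp
  qed
  have "norm (g w1 - g w2) \<le> D * norm (w1 - w2)"
  proof (rule field_differentiable_bound[of "cball 0 t" g "deriv g"])
    fix w assume w: "w \<in> cball (0::complex) t"
    then have w1: "w \<in> ball 0 1" using t by auto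
    show "(g has_field_derivative deriv g w) (at w within cball 0 t)"
      by (rule has_field_derivative_at_within[OF holomorphic_derivI[OF holg open_ball w1]])
    have sub: "cball w d \<subseteq> ball 0 1"
      using d w by (auto simp: subset_iff dist_norm) (smt (verit) norm_triangle_sub norm_minus_commute)
    have "norm ((deriv ^^ 1) g w) \<le> fact 1 * (C * d powr (-e) / d) / d ^ 1"
    proof (rule Cauchy_inequality)
      show "g holomorphic_on ball w d" by (rule holomorphic_on_subset[OF holg]) (use sub in auto)
      show "continuous_on (cball w d) g"
        by (rule continuous_on_subset[OF holomorphic_on_imp_continuous_on[OF holg] sub])
      fix x assume x: "norm (w - x) = d"
      have nx: "norm x \<le> t + d" using x w norm_triangle_sub[of x w] by (simp add: norm_minus_commute)
      have "d \<le> norm (1 - x)" using norm_triangle_ineq2[of 1 x] nx d by simp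
      moreover have "norm (f x) \<le> C * d powr (-e)" using growth_le[OF nx] d by simp
      ultimately show "norm (g x) \<le> C * d powr (-e) / d"
        unfolding norm_divide using d C0 by (intro frac_le) auto
    qed (use d in auto)
    then show "norm (deriv g w) \<le> D" by (simp add: D_def)
  qed (use w in auto)
  then show ?thesis by (simp add: D)
qed

lemma bdry_diff_le:
  obtains A B where "0 \<le> A" "0 \<le> B"
    "\<And>\<theta> \<theta>0 \<eta>. cis \<theta> \<noteq> 1 \<Longrightarrow> 0 < \<eta> \<Longrightarrow> \<eta> \<le> 1 \<Longrightarrow> \<bar>\<theta> - \<theta>0\<bar> \<le> 2 * pi * \<eta> \<Longrightarrow>
      norm (bdry (cesaro_like mu f) \<theta> - cesaro_like mu f (of_real (1 - \<eta>) * cis \<theta>0))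
        \<le> A * \<eta> powr ((lam - 1) / 2 + b) * norm (1 - cis \<theta>) powr (-b) + B * \<eta> powr ((lam - 1) / 2)"
proof -
  define s where "s = (1 + lam) / 2 + e"
  obtain K1 where K1: "0 \<le> K1"
    "\<And>\<eta>. 0 < \<eta> \<Longrightarrow> integrable mu (\<lambda>t. (1 - t) powr (-(e + 1 - b)) * indicator {1-\<eta>..} t)"
    "\<And>\<eta>. 0 < \<eta> \<Longrightarrow> (\<integral>t. (1 - t) powr (-(e + 1 - b)) * indicator {1-\<eta>..} t \<partial>mu) \<le> K1 * \<eta> powr (s - (e + 1 - b))"
    using carleson_integral_near[OF carl, of "e + 1 - b"] b e0 by (auto simp: s_def field_simps)
  obtain K2 where K2: "0 \<le> K2"
    "\<And>\<eta>. 0 < \<eta> \<Longrightarrow> integrable mu (\<lambda>t. (1 - t) powr (-e) * indicator {1-\<eta>..} t)"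
    "\<And>\<eta>. 0 < \<eta> \<Longrightarrow> (\<integral>t. (1 - t) powr (-e) * indicator {1-\<eta>..} t \<partial>mu) \<le> K2 * \<eta> powr (s - e)"
    using carleson_integral_near[OF carl, of e] lam e0 by (auto simp: s_def)
  obtain K3 where K3: "0 \<le> K3"
    "\<And>\<eta>. 0 < \<eta> \<Longrightarrow> integrable mu (\<lambda>t. (1 - t) powr (-(e + 2)) * indicator {..1-\<eta>} t)"
    "\<And>\<eta>. 0 < \<eta> \<Longrightarrow> (\<integral>t. (1 - t) powr (-(e + 2)) * indicator {..1-\<eta>} t \<partial>mu) \<le> K3 * \<eta> powr (s - (e + 2))"
    using carleson_integral_far[OF carl, of "e + 2"] lam e0 by (auto simp: s_def)
  \<comment> \<open>The points \<open>cis \<theta>\<close> and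
    \<open>(1 - \<eta>) * cis \<theta>0\<close> differ by at most \<open>2 * pi * \<eta>\<close> in
    angle and by \<open>\<eta>\<close> in radius, whence \<open>2 * pi + 1\<close>.\<close>
  define E where "E = C * 2 powr (e + 2) * (2 * pi + 1)"
  have E0: "0 \<le> E" using C0 by (simp add: E_def)
  show ?thesis
  proof (rule that[of "C * 2 powr b * K1" "C * K2 + E * K3"])
    fix \<theta> \<theta>0 \<eta> :: real
    assume th: "cis \<theta> \<noteq> 1" and \<eta>: "0 < \<eta>" "\<eta> \<le> 1" and dist: "\<bar>\<theta> - \<theta>0\<bar> \<le> 2 * pi * \<eta>"
    define \<zeta> where "\<zeta> = of_real (1 - \<eta>) * cis \<theta>0"
    have n\<zeta>: "norm \<zeta> = 1 - \<eta>" using \<eta> by (simp add: \<zeta>_def norm_mult del: of_real_diff)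
    have nt\<zeta>: "norm (of_real t * \<zeta>) \<le> min t (1 - \<eta>)" if "t \<in> {0..<1}" for t
      using that \<eta> mult_right_mono[of t 1 "1 - \<eta>"] mult_left_mono[of "1 - \<eta>" 1 t]
      by (auto simp: norm_mult n\<zeta>)
    have den: "\<eta> \<le> norm (1 - of_real t * \<zeta>)" if "t \<in> {0..<1}" for t
      using norm_triangle_ineq2[of 1 "of_real t * \<zeta>"] nt\<zeta>[OF that] by simp
    have int1: "integrable mu (\<lambda>t. g (of_real t * cis \<theta>))"
      using integrable_kernel[of 1 \<theta>] th by simp
    have int2: "integrable mu (\<lambda>t. g (of_real t * \<zeta>))"
    proof (rule integrable_const_bound)
      show "AE t in mu. norm (g (of_real t * \<zeta>)) \<le> C * \<eta> powr (-e) / \<eta>"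
      proof (rule AE_I2)
        fix t assume "t \<in> space mu"
        then have t: "t \<in> {0..<1}" by (simp add: space_mu)
        have "norm (f (of_real t * \<zeta>)) \<le> C * (1 - (1 - \<eta>)) powr (-e)"
          by (rule growth_le) (use nt\<zeta>[OF t] \<eta> in auto)
        then show "norm (g (of_real t * \<zeta>)) \<le> C * \<eta> powr (-e) / \<eta>"
          unfolding norm_divide using \<eta> C0 den[OF t] by (intro frac_le) auto
      qed
      show "(\<lambda>t. g (of_real t * \<zeta>)) \<in> borel_measurable mu" by (rule measurable_kernel) (use n\<zeta> \<eta> in simp)
    qed
    define P where "P = C * 2 powr b * norm (1 - cis \<theta>) powr (-b)"
    have P0: "0 \<le> P" using C0 by (simp add: P_def)
    \<comment> \<open>The first two terms bound the kernels at \<open>cis \<theta>\<close> and at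
      \<open>\<zeta>\<close> separately for t near 1, the second using that
      \<open>1 - t * \<zeta>\<close> has modulus at least \<open>\<eta>\<close>. The third bounds
      their difference for the other t. The overlap of the indicators at \<open>1 - \<eta>\<close>
      is harmless, all terms being nonnegative.\<close>
    let ?H = "\<lambda>t. P * ((1 - t) powr (-(e + 1 - b)) * indicator {1-\<eta>..} t)
        + C / \<eta> * ((1 - t) powr (-e) * indicator {1-\<eta>..} t)
        + E * \<eta> * ((1 - t) powr (-(e + 2)) * indicator {..1-\<eta>} t)"
    have H: "norm (g (of_real t * cis \<theta>) - g (of_real t * \<zeta>)) \<le> ?H t" if "t \<in> space mu" for t
    proof -
      from that have t: "t \<in> {0..<1}" by (simp add: space_mu)
      show ?thesis
      proof (cases "1 - \<eta> \<le> t")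
        case True
        have "norm (g (of_real t * cis \<theta>)) \<le> P * (1 - t) powr (-(e + 1 - b))"
          using kernel_bound[of t 1 \<theta>] t th by (simp add: P_def)
        moreover have "norm (g (of_real t * \<zeta>)) \<le> C * (1 - t) powr (-e) / \<eta>"
          unfolding norm_divide
          by (rule frac_le) (use \<eta> C0 den[OF t] nt\<zeta>[OF t] t in \<open>auto intro!: growth_le\<close>)
        ultimately have "norm (g (of_real t * cis \<theta>) - g (of_real t * \<zeta>))
            \<le> P * (1 - t) powr (-(e + 1 - b)) + C / \<eta> * (1 - t) powr (-e)"
          using norm_triangle_ineq4[of "g (of_real t * cis \<theta>)" "g (of_real t * \<zeta>)"] by simp
        also have "\<dots> \<le> ?H t" using True E0 \<eta> by simp
        finally show ?thesis .
      next
        case False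
        have "norm (of_real t * cis \<theta> - of_real t * \<zeta>) = t * norm (cis \<theta> - \<zeta>)"
          using t by (simp add: norm_mult flip: right_diff_distrib)
        also have "\<dots> \<le> 1 * norm (cis \<theta> - \<zeta>)" using t by (intro mult_right_mono) auto
        also have "cis \<theta> - \<zeta> = (cis \<theta> - cis \<theta>0) + of_real \<eta> * cis \<theta>0"
          by (simp add: \<zeta>_def algebra_simps)
        also have "1 * norm \<dots> \<le> norm (cis \<theta> - cis \<theta>0) + norm (of_real \<eta> * cis \<theta>0)"
          by (simp only: mult_1 norm_triangle_ineq)
        also have "\<dots> \<le> (2 * pi + 1) * \<eta>"
          using norm_cis_diff_le[of \<theta> \<theta>0] dist \<eta> by (simp add: norm_mult algebra_simps)
        finally have nd: "norm (of_real t * cis \<theta> - of_real t * \<zeta>) \<le> (2 * pi + 1) * \<eta>" .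
        have "norm (g (of_real t * cis \<theta>) - g (of_real t * \<zeta>))
          \<le> C * 2 powr (e + 2) * (1 - t) powr (-(e + 2)) * norm (of_real t * cis \<theta> - of_real t * \<zeta>)"
          by (rule kernel_diff_le) (use t nt\<zeta>[OF t] in \<open>auto simp: norm_mult\<close>)
        also have "\<dots> \<le> C * 2 powr (e + 2) * (1 - t) powr (-(e + 2)) * ((2 * pi + 1) * \<eta>)"
          using C0 by (intro mult_left_mono nd) auto
        also have "\<dots> = ?H t" using False by (simp add: E_def mult_ac)
        finally show ?thesis .
      qed
    qed
    note i1 = integrable_mult_right[OF K1(2)[OF \<eta>(1)], of P]
      and i2 = integrable_mult_right[OF K2(2)[OF \<eta>(1)], of "C / \<eta>"]
      and i3 = integrable_mult_right[OF K3(2)[OF \<eta>(1)], of "E * \<eta>"]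
    have eq: "bdry (cesaro_like mu f) \<theta> - cesaro_like mu f \<zeta> = (\<integral>t. g (of_real t * cis \<theta>) - g (of_real t * \<zeta>) \<partial>mu)"
      using th n\<zeta> \<eta> int1 int2 by (simp add: bdry_eq cesaro_eq)
    have "norm (bdry (cesaro_like mu f) \<theta> - cesaro_like mu f \<zeta>) \<le> (\<integral>t. ?H t \<partial>mu)"
      unfolding eq
      by (rule Bochner_Integration.integral_norm_bound_integral[OF
            Bochner_Integration.integrable_diff[OF int1 int2]
            Bochner_Integration.integrable_add[OF Bochner_Integration.integrable_add[OF i1 i2] i3] H])
    also have "\<dots> = P * (\<integral>t. (1 - t) powr (-(e + 1 - b)) * indicator {1-\<eta>..} t \<partial>mu)
        + C / \<eta> * (\<integral>t. (1 - t) powr (-e) * indicator {1-\<eta>..} t \<partial>mu)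
        + E * \<eta> * (\<integral>t. (1 - t) powr (-(e + 2)) * indicator {..1-\<eta>} t \<partial>mu)"
      by (simp only: Bochner_Integration.integral_add[OF Bochner_Integration.integrable_add[OF i1 i2] i3]
          Bochner_Integration.integral_add[OF i1 i2] integral_mult_right_zero)
    also have "\<dots> \<le> P * (K1 * \<eta> powr (s - (e + 1 - b))) + C / \<eta> * (K2 * \<eta> powr (s - e)) + E * \<eta> * (K3 * \<eta> powr (s - (e + 2)))"
      using K1(3)[OF \<eta>(1)] K2(3)[OF \<eta>(1)] K3(3)[OF \<eta>(1)] P0 C0 E0 \<eta> by (intro add_mono mult_left_mono) auto
    also have "\<dots> = P * K1 * \<eta> powr (s - (e + 1 - b)) + C * K2 * (\<eta> powr (s - e) / \<eta> powr 1) + E * K3 * (\<eta> powr (s - (e + 2)) * \<eta> powr 1)"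
      using \<eta> by simp
    \<comment> \<open>The factors \<open>1 / \<eta>\<close> and \<open>\<eta>\<close> bring the last
      two exponents to \<open>(lam - 1) / 2\<close>; the surplus \<open>b\<close> in the first is
      balanced by \<open>norm (1 - cis \<theta>) powr (-b)\<close> inside \<open>P\<close>.\<close>
    also have "\<dots> = P * K1 * \<eta> powr ((lam - 1) / 2 + b) + C * K2 * \<eta> powr ((lam - 1) / 2) + E * K3 * \<eta> powr ((lam - 1) / 2)"
    proof -
      have "s - (e + 1 - b) = (lam - 1) / 2 + b" "s - e - 1 = (lam - 1) / 2" "s - (e + 2) + 1 = (lam - 1) / 2"
        by (simp_all add: s_def field_simps)
      then show ?thesis by (simp only: powr_diff[symmetric] powr_add[symmetric])
    qed
    finally show "norm (bdry (cesaro_like mu f) \<theta> - cesaro_like mu f (of_real (1 - \<eta>) * cis \<theta>0))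
        \<le> C * 2 powr b * K1 * \<eta> powr ((lam - 1) / 2 + b) * norm (1 - cis \<theta>) powr (-b) + (C * K2 + E * K3) * \<eta> powr ((lam - 1) / 2)"
      by (simp only: P_def \<zeta>_def) (simp add: algebra_simps)
  qed (use C0 K1 K2 K3 E0 in auto)
qed

text \<open>The pointwise majorant \<open>W * norm (1 - cis \<theta>) powr (-b)\<close> is the same
  on all circles and square integrable because 2 b < 1.\<close>

lemma cesaro_like_in_hardy_2: "cesaro_like mu f \<in> hardy 2"
proof -
  obtain K where K: "0 \<le> K" "\<And>a l. 0 < l \<Longrightarrow> l \<le> 2 * pi \<Longrightarrow>
    (\<integral>\<^sup>+\<theta>\<in>{a..a+l}. ennreal (norm (1 - cis \<theta>) powr (-(2*b))) \<partial>lborel) \<le> ennreal (K * l powr (1 - 2*b))"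
    using nn_integral_norm_one_minus_cis_powr_le[of "2*b"] b by auto
  define W where "W = C * 2 powr b * (\<integral>t. (1 - t) powr (-(e + 1 - b)) \<partial>mu)"
  have bound: "norm (cesaro_like mu f (of_real r * cis \<theta>)) \<le> W * norm (1 - cis \<theta>) powr (-b)"
    if r: "r \<in> {0<..<1}" and th: "cis \<theta> \<noteq> 1" for r \<theta>
  proof -
    have "norm (cesaro_like mu f (of_real r * cis \<theta>)) = norm (\<integral>t. g (of_real t * (of_real r * cis \<theta>)) \<partial>mu)"
      using r by (subst cesaro_eq) (auto simp: norm_mult)
    also have "\<dots> \<le> (\<integral>t. C * 2 powr b * norm (1 - cis \<theta>) powr (-b) * (1 - t) powr (-(e + 1 - b)) \<partial>mu)"
      by (rule Bochner_Integration.integral_norm_bound_integral[OF integrable_kernel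
            integrable_mult_right[OF integrable_weight] kernel_bound])
         (use r th in \<open>auto simp: space_mu\<close>)
    finally show ?thesis by (simp add: W_def mult_ac)
  qed
  have "(\<integral>\<^sup>+\<theta>\<in>{0..2*pi}. ennreal (norm (cesaro_like mu f (of_real r * cis \<theta>)) powr 2) \<partial>lborel)
      \<le> ennreal (W\<^sup>2 * (K * (2*pi) powr (1 - 2*b)))" if r: "r \<in> {0<..<1}" for r
  proof -
    have "(\<integral>\<^sup>+\<theta>\<in>{0..2*pi}. ennreal (norm (cesaro_like mu f (of_real r * cis \<theta>)) powr 2) \<partial>lborel)
       \<le> (\<integral>\<^sup>+\<theta>. ennreal (W\<^sup>2) * (ennreal (norm (1 - cis \<theta>) powr (-(2*b))) * indicator {0..0+2*pi} \<theta>) \<partial>lborel)"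
    proof (rule nn_integral_mono_AE)
      have "norm (cesaro_like mu f (of_real r * cis \<theta>)) powr 2 \<le> W\<^sup>2 * norm (1 - cis \<theta>) powr (-(2*b))" if "cis \<theta> \<noteq> 1" for \<theta>
      proof -
        have "(norm (cesaro_like mu f (of_real r * cis \<theta>)))\<^sup>2 \<le> (W * norm (1 - cis \<theta>) powr (-b))\<^sup>2"
          by (intro power_mono bound r that) auto
        also have "\<dots> = W\<^sup>2 * norm (1 - cis \<theta>) powr (-(2*b))"
          by (simp add: power_mult_distrib) (simp add: power2_eq_square flip: powr_add)
        finally show ?thesis by simp
      qed
      then show "AE \<theta> in lborel. ennreal (norm (cesaro_like mu f (of_real r * cis \<theta>)) powr 2) * indicator {0..2*pi} \<theta>
         \<le> ennreal (W\<^sup>2) * (ennreal (norm (1 - cis \<theta>) powr (-(2*b))) * indicator {0..0+2*pi} \<theta>)"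
        using AE_cis_neq_1 by (auto elim!: eventually_mono simp: indicator_def ennreal_leI simp flip: ennreal_mult')
    qed
    also have "\<dots> = ennreal (W\<^sup>2) * (\<integral>\<^sup>+\<theta>\<in>{0..0+2*pi}. ennreal (norm (1 - cis \<theta>) powr (-(2*b))) \<partial>lborel)"
      by (rule nn_integral_cmult) measurable
    also have "\<dots> \<le> ennreal (W\<^sup>2) * ennreal (K * (2*pi) powr (1 - 2*b))"
      by (intro mult_left_mono K) auto
    finally show ?thesis by (simp add: ennreal_mult')
  qed
  then have "\<exists>M. \<forall>r\<in>{0<..<1}. (\<integral>\<^sup>+\<theta>\<in>{0..2*pi}. ennreal (norm (cesaro_like mu f (of_real r * cis \<theta>)) powr 2) \<partial>lborel) \<le> ennreal M"
    by blast
  moreover have "analytic_disc (cesaro_like mu f)"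
    using holomorphic_cesaro_like[OF holf] by (auto simp: analytic_disc_def unit_disc_def cesaro_like_def)
  moreover have "(2::ereal) \<noteq> \<infinity>" "real_of_ereal 2 = 2" by auto
  ultimately show ?thesis unfolding hardy_def by simp
qed

lemma cesaro_like_in_morrey: "cesaro_like mu f \<in> morrey lam"
proof -
  obtain A B where AB: "0 \<le> A" "0 \<le> B" 
    "\<And>\<theta> \<theta>0 \<eta>. cis \<theta> \<noteq> 1 \<Longrightarrow> 0 < \<eta> \<Longrightarrow> \<eta> \<le> 1 \<Longrightarrow> \<bar>\<theta> - \<theta>0\<bar> \<le> 2 * pi * \<eta> \<Longrightarrow>
      norm (bdry (cesaro_like mu f) \<theta> - cesaro_like mu f (of_real (1 - \<eta>) * cis \<theta>0))
        \<le> A * \<eta> powr ((lam - 1) / 2 + b) * norm (1 - cis \<theta>) powr (-b) + B * \<eta> powr ((lam - 1) / 2)"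
    using bdry_diff_le by blast
  let ?\<tau> = "(lam - 1) / 2"
  \<comment> \<open>An arc of length l corresponds to \<open>\<eta> = l / (2*pi)\<close>; the powers
    of \<open>2*pi\<close> go into the constants. For the full circle the comparison point is the
    centre of the disc.\<close>
  define A' where "A' = A / (2*pi) powr (?\<tau> + b)"
  define B' where "B' = B / (2*pi) powr ?\<tau>"
  have osc: "\<exists>c. \<forall>\<theta>\<in>{a..a+l}. cis \<theta> \<noteq> 1 \<longrightarrow>
      norm (bdry (cesaro_like mu f) \<theta> - c) \<le> A' * l powr (?\<tau> + b) * norm (1 - cis \<theta>) powr (-b) + B' * l powr ?\<tau>"
    if l: "0 < l" "l \<le> 2 * pi" for a l
  proof (intro exI ballI impI)
    fix \<theta> assume "\<theta> \<in> {a..a+l}" and "cis \<theta> \<noteq> 1"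
    then have "norm (bdry (cesaro_like mu f) \<theta> - cesaro_like mu f (of_real (1 - l / (2*pi)) * cis a))
        \<le> A * (l / (2*pi)) powr (?\<tau> + b) * norm (1 - cis \<theta>) powr (-b) + B * (l / (2*pi)) powr ?\<tau>"
      using l by (intro AB(3)) auto
    also have "\<dots> = A' * l powr (?\<tau> + b) * norm (1 - cis \<theta>) powr (-b) + B' * l powr ?\<tau>"
      using l by (simp add: A'_def B'_def powr_divide)
    finally show "norm (bdry (cesaro_like mu f) \<theta> - cesaro_like mu f (of_real (1 - l / (2*pi)) * cis a))
       \<le> A' * l powr (?\<tau> + b) * norm (1 - cis \<theta>) powr (-b) + B' * l powr ?\<tau>" .
  qed
  have "0 \<le> A'" "0 \<le> B'" using AB by (auto simp: A'_def B'_def)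
  from arc_oscillation_le[OF measurable_bdry b(1,2) this osc]
  obtain M where M: "\<And>a l. 0 < l \<Longrightarrow> l \<le> 2 * pi \<Longrightarrow>
     (\<integral>\<^sup>+\<theta>\<in>{a..a+l}. ennreal ((norm (bdry (cesaro_like mu f) \<theta> - arc_mean (cesaro_like mu f) a l))\<^sup>2) \<partial>lborel)
       \<le> ennreal (M * l powr (2 * ?\<tau> + 1))"
    unfolding arc_mean_def by blast
  have "2 * ?\<tau> + 1 = lam" by (simp add: field_simps)
  with M show ?thesis using cesaro_like_in_hardy_2 by (auto simp: morrey_def)
qed

end

subsection \<open>Test functions and the lower bound\<close>

text \<open>On the circle of radius \<open>\<rho> = a * r\<close> the real part of (1 + w) / (1 - w)
  is the Poisson kernel, whose mean is its value 1 at the centre. Replacing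
  \<open>1 - \<rho>\<^sup>2\<close> by the smaller \<open>1 - a\<^sup>2\<close> only decreases the
  integrand.\<close>

lemma nn_integral_poisson_kernel_le:
  assumes a: "0 < a" "a < 1" and r: "0 < r" "r < 1"
  shows "(\<integral>\<^sup>+\<theta>\<in>{0..2*pi}. ennreal ((1 - a\<^sup>2) / (norm (1 - of_real a * (of_real r * cis \<theta>)))\<^sup>2) \<partial>lborel) \<le> ennreal (2 * pi)"
proof -
  define \<rho> where "\<rho> = a * r"
  have \<rho>: "0 < \<rho>" "\<rho> < 1" "\<rho> \<le> a" using a r mult_strict_mono[of a 1 r 1] mult_left_mono[of r 1 a] by (auto simp: \<rho>_def)
  define k where "k w = (1 + w) / (1 - w)" for w :: complex
  have "k holomorphic_on cball 0 \<rho>"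
    unfolding k_def using \<rho> by (intro holomorphic_intros) auto
  then have "((\<lambda>u. k u / (u - 0)) has_contour_integral 2 * of_real pi * \<i> * k 0) (circlepath 0 \<rho>)"
    by (rule Cauchy_integral_circlepath_simple) (use \<rho> in auto)
  then have "((\<lambda>t. k (of_real \<rho> * cis t) / (of_real \<rho> * cis t) * of_real \<rho> * \<i> * cis t)
      has_integral 2 * of_real pi * \<i>) {0..2*pi}"
    by (subst (asm) circlepath_def, subst (asm) has_contour_integral_part_circlepath_iff) (auto simp: k_def)
  then have "((\<lambda>t. \<i> * k (of_real \<rho> * cis t)) has_integral 2 * of_real pi * \<i>) {0..2*pi}"
    using \<rho> by (simp add: mult.commute)
  from has_integral_linear[OF this bounded_linear_Im]
  have I: "((\<lambda>t. Re (k (of_real \<rho> * cis t))) has_integral 2 * pi) {0..2*pi}"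
    by (simp add: o_def)
  have Re_k: "Re (k w) = (1 - (norm w)\<^sup>2) / (norm (1 - w))\<^sup>2" for w
    by (simp add: k_def Re_divide cmod_power2) (simp add: power2_eq_square algebra_simps)
  have "(\<integral>\<^sup>+\<theta>\<in>{0..2*pi}. ennreal (Re (k (of_real \<rho> * cis \<theta>))) \<partial>lborel) = ennreal (2 * pi)"
    by (rule nn_integral_Icc_eq_of_has_integral[OF _ _ I])
       (use \<rho> in \<open>auto simp: Re_k norm_mult power_le_one\<close>)
  moreover have "(\<integral>\<^sup>+\<theta>\<in>{0..2*pi}. ennreal ((1 - a\<^sup>2) / (norm (1 - of_real a * (of_real r * cis \<theta>)))\<^sup>2) \<partial>lborel)
     \<le> (\<integral>\<^sup>+\<theta>\<in>{0..2*pi}. ennreal (Re (k (of_real \<rho> * cis \<theta>))) \<partial>lborel)"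
  proof (intro nn_integral_mono mult_right_mono ennreal_leI)
    fix \<theta>
    have "\<rho>\<^sup>2 \<le> a\<^sup>2" using \<rho> by (intro power_mono) auto
    then have "(1 - a\<^sup>2) / (norm (1 - of_real \<rho> * cis \<theta>))\<^sup>2 \<le> (1 - \<rho>\<^sup>2) / (norm (1 - of_real \<rho> * cis \<theta>))\<^sup>2"
      by (intro divide_right_mono) auto
    then show "(1 - a\<^sup>2) / (norm (1 - of_real a * (of_real r * cis \<theta>)))\<^sup>2 \<le> Re (k (of_real \<rho> * cis \<theta>))"
      using \<rho> a r by (simp add: Re_k norm_mult \<rho>_def mult_ac)
  qed auto
  ultimately show ?thesis by simp
qed

text \<open>A substitute for the triangle inequality that treats P below and above 1 alike. One
  factor \<open>(1/2) ^ k\<close> of the weight stays with \<open>x k\<close>, where each term is at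
  most the P-th root of the sum T of their P-th powers; the other factor is summed to 2.\<close>

lemma suminf_powr_le:
  fixes x :: "nat \<Rightarrow> real"
  assumes P: "0 < P" and x: "\<And>k. 0 \<le> x k" "\<And>k. x k \<le> L"
  shows "summable (\<lambda>k. (1/4) ^ k * x k)" "summable (\<lambda>k. ((1/2) ^ k * x k) powr P)"
    "(\<Sum>k. (1/4) ^ k * x k) powr P \<le> 2 powr P * (\<Sum>k. ((1/2) ^ k * x k) powr P)"
proof -
  show s4: "summable (\<lambda>k. (1/4) ^ k * x k)"
    by (rule summable_comparison_test'[of "\<lambda>k. (1/4) ^ k * L"])
       (use x in \<open>auto intro!: summable_mult2 mult_left_mono\<close>)
  have L: "0 \<le> L" using x(1)[of 0] x(2)[of 0] by linarith
  have term_le: "((1/2) ^ k * x k) powr P \<le> ((1/2) powr P) ^ k * L powr P" for k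
  proof -
    have "((1/2) ^ k * x k) powr P \<le> ((1/2) ^ k * L) powr P"
      using x P by (intro powr_mono2 mult_left_mono) auto
    also have "\<dots> = ((1/2) powr P) ^ k * L powr P"
      using L by (simp add: powr_mult powr_powr mult_ac flip: powr_realpow)
    finally show ?thesis .
  qed
  have "(1/2) powr P < (1::real)" using powr_less_mono2[of P "1/2" 1] P by simp
  then have "summable (\<lambda>k. ((1/2) powr P) ^ k * L powr P)" by (intro summable_mult2) simp
  then show sT: "summable (\<lambda>k. ((1/2) ^ k * x k) powr P)"
    by (rule summable_comparison_test') (use term_le in auto)
  define T where "T = (\<Sum>k. ((1/2) ^ k * x k) powr P)"
  have T0: "0 \<le> T" unfolding T_def by (intro suminf_nonneg sT) auto
  have le: "(1/2) ^ k * x k \<le> T powr (1/P)" for k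
  proof -
    have "((1/2) ^ k * x k) powr P \<le> T"
      unfolding T_def using sum_le_suminf[OF sT, of "{k}"] by simp
    then have "(((1/2) ^ k * x k) powr P) powr (1/P) \<le> T powr (1/P)"
      using P by (intro powr_mono2) auto
    then show ?thesis using x(1)[of k] P by (simp add: powr_powr)
  qed
  have "(1/4) ^ k * x k \<le> (1/2) ^ k * T powr (1/P)" for k
    using mult_left_mono[OF le[of k], of "(1/2) ^ k"] by (simp add: power_mult_distrib[symmetric] flip: mult.assoc)
  then have "(\<Sum>k. (1/4) ^ k * x k) \<le> (\<Sum>k. (1/2) ^ k * T powr (1/P))"
    using s4 by (intro suminf_le) (auto intro!: summable_mult2)
  also have "\<dots> = 2 * T powr (1/P)"
    using suminf_mult2[of "\<lambda>k. (1/2::real) ^ k" "T powr (1/P)"] suminf_geometric[of "1/2::real"] by simp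
  finally have "(\<Sum>k. (1/4) ^ k * x k) powr P \<le> (2 * T powr (1/P)) powr P"
    using P x s4 by (intro powr_mono2) (auto intro!: suminf_nonneg)
  also have "\<dots> = 2 powr P * T" using P T0 by (simp add: powr_mult powr_powr)
  finally show "(\<Sum>k. (1/4) ^ k * x k) powr P \<le> 2 powr P * (\<Sum>k. ((1/2) ^ k * x k) powr P)"
    by (simp add: T_def)
qed

text \<open>The exponent is chosen so that for \<open>\<alpha> = 1/P\<close> the \<open>P\<close>-th power of the modulus is dominated by
  a Poisson kernel.\<close>
definition szego_power :: "real \<Rightarrow> real \<Rightarrow> complex \<Rightarrow> complex" where
  "szego_power \<alpha> a z = of_real ((1 - a\<^sup>2) powr \<alpha>) * (1 - of_real a * z) powr of_real (- 2 * \<alpha>)"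

text \<open>The real part of 1 - a z is positive, which keeps the principal power away from its
  branch cut.\<close>

lemma one_minus_scaled_disc:
  fixes z :: complex
  assumes "0 \<le> a" "a < 1" "norm z < 1"
  shows "1 - of_real a * z \<notin> \<real>\<^sub>\<le>\<^sub>0" "1 - of_real a * z \<noteq> 0" "1 - norm z \<le> norm (1 - of_real a * z)"
proof -
  have n: "norm (of_real a * z) \<le> norm z" using assms mult_right_mono[of a 1 "norm z"] by (simp add: norm_mult)
  have "Re (of_real a * z) \<le> norm (of_real a * z)" by (rule complex_Re_le_cmod)
  with n assms have "0 < Re (1 - of_real a * z)" by simp
  then show *: "1 - of_real a * z \<notin> \<real>\<^sub>\<le>\<^sub>0"
    by (auto simp: complex_nonpos_Reals_iff)
  then show "1 - of_real a * z \<noteq> 0" by force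
  show "1 - norm z \<le> norm (1 - of_real a * z)"
    using norm_triangle_ineq2[of 1 "of_real a * z"] n by simp
qed

lemma norm_szego_power:
  assumes "0 \<le> a" "a < 1" "norm z < 1"
  shows "norm (szego_power \<alpha> a z) = (1 - a\<^sup>2) powr \<alpha> * norm (1 - of_real a * z) powr (- 2 * \<alpha>)"
  using one_minus_scaled_disc[OF assms] by (simp add: szego_power_def norm_mult norm_powr_real_powr' del: of_real_mult of_real_minus)

lemma norm_szego_power_le:
  assumes a: "0 \<le> a" "a < 1" and z: "norm z \<le> \<rho>" "\<rho> < 1" and \<alpha>: "0 \<le> \<alpha>"
  shows "norm (szego_power \<alpha> a z) \<le> (1 - \<rho>) powr (- 2 * \<alpha>)"
proof -
  have z1: "norm z < 1" using z by simp
  have a2: "a\<^sup>2 \<le> 1" using a by (simp add: power_le_one)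
  have "(1 - a\<^sup>2) powr \<alpha> \<le> 1" using a2 \<alpha> by (intro powr_le1) auto
  moreover have "norm (1 - of_real a * z) powr (- 2 * \<alpha>) \<le> (1 - \<rho>) powr (- 2 * \<alpha>)"
    using one_minus_scaled_disc(3)[OF a z1] z \<alpha> by (intro powr_mono2') auto
  ultimately have "(1 - a\<^sup>2) powr \<alpha> * norm (1 - of_real a * z) powr (- 2 * \<alpha>) \<le> 1 * (1 - \<rho>) powr (- 2 * \<alpha>)"
    by (intro mult_mono) auto
  then show ?thesis using norm_szego_power[OF a z1] by simp
qed

lemma szego_power_of_real:
  assumes "0 \<le> a" "a < 1" "0 \<le> x" "x < 1"
  shows "szego_power \<alpha> a (of_real x) = of_real ((1 - a\<^sup>2) powr \<alpha> * (1 - a * x) powr (- 2 * \<alpha>))"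
proof -
  have "0 \<le> 1 - a * x" using assms mult_mono[of a 1 x 1] by simp
  then have "of_real (1 - a * x) powr of_real (- 2 * \<alpha>) = complex_of_real ((1 - a * x) powr (- 2 * \<alpha>))"
    by (rule powr_of_real)
  then show ?thesis by (simp add: szego_power_def)
qed

lemma holomorphic_szego_power:
  "0 \<le> a \<Longrightarrow> a < 1 \<Longrightarrow> szego_power \<alpha> a holomorphic_on ball 0 1"
  unfolding szego_power_def using one_minus_scaled_disc
  by (intro holomorphic_intros) auto

text \<open>The P-th power of the modulus of the k-th function has circle integrals at most 2 pi,
  whatever \<open>a k\<close> is. By \<open>suminf_powr_le\<close> the integrals for the
  superposition are bounded by a geometric series of ratio \<open>(1/2) powr P\<close>. Holomorphy
  comes from locally uniform convergence.\<close>

lemma szego_series_in_hardy: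
  fixes a :: "nat \<Rightarrow> real" and P :: real
  assumes P: "0 < P" and a: "\<And>k. 0 < a k" "\<And>k. a k < 1"
  shows "(\<lambda>z. if z \<in> unit_disc then (\<Sum>k. (1/4) ^ k * szego_power (1/P) (a k) z) else 0) \<in> hardy (ereal P)"
    (is "?f \<in> _")
proof -
  let ?K = "\<lambda>k. szego_power (1/P) (a k)"
  have a': "0 \<le> a k" "a k < 1" for k using a[of k] by auto
  have bd: "norm (?K k z) \<le> (1 - \<rho>) powr (- 2 * (1/P))" if "norm z \<le> \<rho>" "\<rho> < 1" for k z \<rho>
    by (rule norm_szego_power_le[OF a' that]) (use P in auto)
  have "(\<lambda>z. \<Sum>k. (1/4) ^ k * ?K k z) holomorphic_on ball 0 1"
  proof (rule holomorphic_uniform_sequence[of _ "\<lambda>n z. \<Sum>k<n. (1/4) ^ k * ?K k z"])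
    show "(\<lambda>z. \<Sum>k<n. (1/4) ^ k * ?K k z) holomorphic_on ball 0 1" for n
      by (intro holomorphic_intros holomorphic_szego_power a')
    fix z :: complex assume z: "z \<in> ball 0 1"
    define d where "d = (1 - norm z) / 2"
    have d: "0 < d" "norm z + d < 1" using z by (auto simp: d_def field_simps)
    have nw: "norm w \<le> norm z + d" if "w \<in> cball z d" for w
      using that norm_triangle_sub[of w z] by (simp add: dist_norm norm_minus_commute)
    have "uniform_limit (cball z d) (\<lambda>n w. \<Sum>k<n. (1/4) ^ k * ?K k w) (\<lambda>w. \<Sum>k. (1/4) ^ k * ?K k w) sequentially"
    proof (rule Weierstrass_m_test)
      show "norm ((1/4) ^ k * ?K k w) \<le> (1/4) ^ k * (1 - (norm z + d)) powr (- 2 * (1/P))" if "w \<in> cball z d" for k w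
        unfolding norm_mult using bd[OF nw[OF that] d(2), of k]
        by (intro mult_mono) (auto simp: norm_power norm_divide)
      show "summable (\<lambda>k. (1/4) ^ k * (1 - (norm z + d)) powr (- 2 * (1/P)))"
        by (intro summable_mult2) simp
    qed
    moreover have "cball z d \<subseteq> ball 0 1" using nw d by force
    ultimately show "\<exists>d>0. cball z d \<subseteq> ball 0 1 \<and>
       uniform_limit (cball z d) (\<lambda>n w. \<Sum>k<n. (1/4) ^ k * ?K k w) (\<lambda>w. \<Sum>k. (1/4) ^ k * ?K k w) sequentially"
      using d by blast
  qed auto
  then have "?f holomorphic_on ball 0 1"
    by (rule holomorphic_transform) (auto simp: unit_disc_def)
  then have an: "analytic_disc ?f" by (auto simp: analytic_disc_def unit_disc_def)
  define q where "q = (1/2) powr P"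
  have q: "0 \<le> q" "q < 1" using powr_less_mono2[of P "1/2" 1] P by (auto simp: q_def)
  have "(\<integral>\<^sup>+\<theta>\<in>{0..2*pi}. ennreal (norm (?f (of_real r * cis \<theta>)) powr P) \<partial>lborel)
      \<le> ennreal (2 powr P * (2 * pi) * (1 / (1 - q)))" if "r \<in> {0<..<1}" for r
  proof -
    from that have r: "0 < r" "r < 1" by auto
    define y where "y k \<theta> = (1 - (a k)\<^sup>2) / (norm (1 - of_real (a k) * (of_real r * cis \<theta>)))\<^sup>2" for k \<theta>
    have y0: "0 \<le> y k \<theta>" for k \<theta> using a'[of k] by (simp add: y_def power_le_one)
    have [measurable]: "y k \<in> borel_measurable borel" for k unfolding y_def by measurable
    have pt: "ennreal (norm (?f (of_real r * cis \<theta>)) powr P)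
        \<le> (\<Sum>k. ennreal (2 powr P * q ^ k) * ennreal (y k \<theta>))" for \<theta>
    proof -
      let ?z = "of_real r * cis \<theta>"
      have nz: "norm ?z = r" "norm ?z < 1" using r by (auto simp: norm_mult)
      define x where "x k = norm (?K k ?z)" for k
      have xL: "x k \<le> (1 - r) powr (- 2 * (1/P))" for k unfolding x_def by (rule bd) (use nz r in auto)
      have x0: "0 \<le> x k" for k by (simp add: x_def)
      note S = suminf_powr_le[of P x, OF P x0 xL]
      have xP: "x k powr P = y k \<theta>" for k
      proof -
        have "1 - of_real (a k) * ?z \<noteq> 0" by (rule one_minus_scaled_disc(2)[OF a' nz(2)])
        moreover have "(a k)\<^sup>2 \<le> 1" using a'[of k] by (simp add: power_le_one)
        ultimately show ?thesis using P
          by (simp add: x_def norm_szego_power[OF a' nz(2)] y_def powr_mult powr_powr)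
            (simp add: powr_minus divide_inverse)
      qed
      have term_eq: "((1/2) ^ k * x k) powr P = q ^ k * y k \<theta>" for k
      proof -
        have "((1/2) ^ k * x k) powr P = ((1/2) ^ k) powr P * y k \<theta>"
          using x0[of k] by (simp add: powr_mult xP)
        also have "((1/2::real) ^ k) powr P = q ^ k"
          by (simp add: q_def powr_powr mult_ac flip: powr_realpow)
        finally show ?thesis .
      qed
      have nt: "norm ((1/4) ^ k * ?K k ?z) = (1/4) ^ k * x k" for k
        by (simp add: norm_mult norm_power norm_divide x_def)
      have "norm (?f ?z) \<le> (\<Sum>k. (1/4) ^ k * x k)"
        using nz(2) summable_norm[of "\<lambda>k. (1/4) ^ k * ?K k ?z"] S(1) unfolding nt by (simp add: unit_disc_def)
      then have "norm (?f ?z) powr P \<le> (\<Sum>k. (1/4) ^ k * x k) powr P"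
        using P by (intro powr_mono2) auto
      also have "\<dots> \<le> 2 powr P * (\<Sum>k. q ^ k * y k \<theta>)" using S(3) by (simp only: term_eq)
      also have "\<dots> = (\<Sum>k. 2 powr P * (q ^ k * y k \<theta>))"
        using suminf_mult[OF S(2), of "2 powr P"] by (simp only: term_eq)
      finally have "ennreal (norm (?f ?z) powr P) \<le> ennreal (\<Sum>k. 2 powr P * (q ^ k * y k \<theta>))"
        by (rule ennreal_leI)
      also have "\<dots> = (\<Sum>k. ennreal (2 powr P * (q ^ k * y k \<theta>)))"
        by (rule suminf_ennreal2[symmetric])
           (use q y0 summable_mult[OF S(2), of "2 powr P"] in \<open>auto simp: term_eq\<close>)
      also have "\<dots> = (\<Sum>k. ennreal (2 powr P * q ^ k) * ennreal (y k \<theta>))"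
        using q y0 by (simp add: ennreal_mult' mult_ac)
      finally show ?thesis .
    qed
    have "(\<integral>\<^sup>+\<theta>\<in>{0..2*pi}. ennreal (norm (?f (of_real r * cis \<theta>)) powr P) \<partial>lborel)
       \<le> (\<integral>\<^sup>+\<theta>. (\<Sum>k. ennreal (2 powr P * q ^ k) * (ennreal (y k \<theta>) * indicator {0..2*pi} \<theta>)) \<partial>lborel)"
    proof (rule nn_integral_mono)
      fix \<theta>
      show "ennreal (norm (?f (of_real r * cis \<theta>)) powr P) * indicator {0..2*pi} \<theta>
         \<le> (\<Sum>k. ennreal (2 powr P * q ^ k) * (ennreal (y k \<theta>) * indicator {0..2*pi} \<theta>))"
        using pt[of \<theta>] by (cases "\<theta> \<in> {0..2*pi}") auto
    qed
    also have "\<dots> = (\<Sum>k. ennreal (2 powr P * q ^ k) * (\<integral>\<^sup>+\<theta>\<in>{0..2*pi}. ennreal (y k \<theta>) \<partial>lborel))"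
      by (simp add: nn_integral_suminf nn_integral_cmult)
    also have "\<dots> \<le> (\<Sum>k. ennreal (2 powr P * q ^ k) * ennreal (2 * pi))"
      unfolding y_def using nn_integral_poisson_kernel_le[OF a r]
      by (intro suminf_le mult_left_mono) auto
    also have "\<dots> = (\<Sum>k. ennreal (2 powr P * (2 * pi) * q ^ k))"
      using q by (simp add: mult_ac flip: ennreal_mult')
    also have "\<dots> = ennreal (2 powr P * (2 * pi) * (1 / (1 - q)))"
    proof (rule suminf_ennreal_eq)
      show "(\<lambda>k. 2 powr P * (2 * pi) * q ^ k) sums (2 powr P * (2 * pi) * (1 / (1 - q)))"
        using q by (intro sums_mult geometric_sums) simp
    qed (use q in auto)
    finally show ?thesis .
  qed
  then have "\<exists>M. \<forall>r\<in>{0<..<1}. (\<integral>\<^sup>+\<theta>\<in>{0..2*pi}. ennreal (norm (?f (of_real r * cis \<theta>)) powr P) \<partial>lborel) \<le> ennreal M"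
    by blast
  with an show ?thesis unfolding hardy_def by simp
qed


text \<open>The lower bound is placed at the square of \<open>a k\<close> because the derivative
  estimate evaluates \<open>\<phi>\<close> at products t a with t at least a. It comes from the k-th
  summand alone, the others being nonnegative there. For p = \<open>\<infinity>\<close> no growth is
  required and the constant 1 serves.\<close>

lemma hardy_test_function:
  fixes a :: "nat \<Rightarrow> real"
  assumes p: "0 < p" and a: "\<And>k. 0 < a k" "\<And>k. a k < 1"
  obtains f \<phi> \<kappa> where "f \<in> hardy p" "0 < \<kappa>"
    "\<And>x. x \<in> {0..<1} \<Longrightarrow> f (of_real x) = of_real (\<phi> x)"
    "\<And>x y. 0 \<le> x \<Longrightarrow> x \<le> y \<Longrightarrow> y < 1 \<Longrightarrow> 0 \<le> \<phi> x \<and> \<phi> x \<le> \<phi> y"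
    "\<And>k. \<kappa> * (1/4) ^ k * (1 - a k) powr (- inv_exp p) \<le> \<phi> ((a k)\<^sup>2)"
proof (cases "p = \<infinity>")
  case True
  show ?thesis
  proof (rule that[of "\<lambda>z. if z \<in> unit_disc then 1 else 0" 1 "\<lambda>_. 1"])
    have "(\<lambda>z. if z \<in> unit_disc then 1 else 0 :: complex) holomorphic_on unit_disc"
      by (rule holomorphic_transform[of "\<lambda>_. 1"]) auto
    then show "(\<lambda>z. if z \<in> unit_disc then 1 else 0) \<in> hardy p"
      using True by (auto simp: hardy_def analytic_disc_def intro!: exI[of _ 1])
    show "1 * (1/4) ^ k * (1 - a k) powr (- inv_exp p) \<le> 1" for k
      using True a[of k] by (simp add: inv_exp_def power_le_one)
  qed (auto simp: unit_disc_def)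
next
  case False
  then obtain P where pP: "p = ereal P" using p by (cases p) auto
  with p have P: "0 < P" by simp
  have inv: "inv_exp p = 1/P" by (simp add: inv_exp_def pP)
  let ?f = "\<lambda>z. if z \<in> unit_disc then (\<Sum>k. (1/4) ^ k * szego_power (1/P) (a k) z) else 0"
  define c where "c k x = (1/4) ^ k * ((1 - (a k)\<^sup>2) powr (1/P) * (1 - a k * x) powr (- 2 * (1/P)))" for k x
  define \<phi> where "\<phi> x = (\<Sum>k. c k x)" for x
  have c0: "0 \<le> c k x" for k x by (simp add: c_def)
  have a': "0 \<le> a k" "a k < 1" for k using a[of k] by auto
  have c_eq: "of_real (c k x) = (1/4) ^ k * szego_power (1/P) (a k) (of_real x)"
    and c_le: "c k x \<le> (1/4) ^ k * (1 - x) powr (- 2 * (1/P))" if "0 \<le> x" "x < 1" for k x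
  proof -
    show 1: "of_real (c k x) = (1/4) ^ k * szego_power (1/P) (a k) (of_real x)"
      unfolding c_def szego_power_of_real[OF a' that] by simp
    have "c k x = norm (complex_of_real (c k x))" using c0[of k x] by simp
    also have "\<dots> = (1/4) ^ k * norm (szego_power (1/P) (a k) (of_real x))"
      unfolding 1 by (simp add: norm_mult norm_power norm_divide)
    also have "\<dots> \<le> (1/4) ^ k * (1 - x) powr (- 2 * (1/P))"
      by (intro mult_left_mono norm_szego_power_le a') (use that P in auto)
    finally show "c k x \<le> (1/4) ^ k * (1 - x) powr (- 2 * (1/P))" .
  qed
  have summ: "summable (\<lambda>k. c k x)" if "0 \<le> x" "x < 1" for x
  proof (rule summable_comparison_test')
    show "summable (\<lambda>k. (1/4) ^ k * (1 - x) powr (- 2 * (1/P)))" by (intro summable_mult2) simp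
  qed (use c_le[OF that] c0 in auto)
  have mono: "c k x \<le> c k y" if "0 \<le> x" "x \<le> y" "y < 1" for k x y
  proof -
    have "a k * x \<le> a k * y" "a k * y < 1"
      using that a'[of k] mult_left_mono[of x y "a k"] mult_left_mono[of y 1 "a k"] by auto
    then have "(1 - a k * x) powr (- 2 * (1/P)) \<le> (1 - a k * y) powr (- 2 * (1/P))"
      using P by (intro powr_mono2') auto
    then show ?thesis unfolding c_def by (intro mult_left_mono) auto
  qed
  show ?thesis
  proof (rule that[of ?f "3 powr (- 2 * (1/P))" \<phi>])
    show "?f \<in> hardy p" unfolding pP by (rule szego_series_in_hardy[OF P a])
    show "?f (of_real x) = of_real (\<phi> x)" if "x \<in> {0..<1}" for x
    proof -
      from that have x: "0 \<le> x" "x < 1" by auto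
      have "complex_of_real (\<phi> x) = (\<Sum>k. of_real (c k x))"
        unfolding \<phi>_def by (rule suminf_of_real[OF summ[OF x]])
      then show ?thesis using x by (simp add: unit_disc_def c_eq)
    qed
    show "0 \<le> \<phi> x \<and> \<phi> x \<le> \<phi> y" if "0 \<le> x" "x \<le> y" "y < 1" for x y
      unfolding \<phi>_def using that by (intro conjI suminf_nonneg suminf_le summ mono c0) auto
    fix k
    have ak: "0 < a k" "a k < 1" by (rule a)+
    have a2: "(a k)\<^sup>2 < 1" "(a k)\<^sup>2 \<le> a k" "a k ^ 3 \<le> 1"
      using ak mult_strict_mono[of "a k" 1 "a k" 1] by (auto simp: power2_eq_square mult_left_le power_le_one)
    \<comment> \<open>At this point the base of the k-th summand is 1 - a^3, at most 3 (1 - a); this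
      is the origin of the 3 in the constant \<open>3 powr (- 2 * (1/P))\<close>.\<close>
    have "1 - a k * (a k)\<^sup>2 = (1 - a k) * (1 + a k + (a k)\<^sup>2)" by (simp add: algebra_simps power2_eq_square)
    also have "\<dots> \<le> (1 - a k) * 3" using ak a2 by (intro mult_left_mono) auto
    finally have le3: "1 - a k * (a k)\<^sup>2 \<le> 3 * (1 - a k)" by simp
    have pos: "0 < 1 - a k * (a k)\<^sup>2" using ak a2 mult_strict_mono[of "a k" 1 "(a k)\<^sup>2" 1] by simp
    have "3 powr (- 2 * (1/P)) * (1 - a k) powr (- (1/P))
      = (1 - a k) powr (1/P) * (3 * (1 - a k)) powr (- 2 * (1/P))"
    proof -
      have "(1 - a k) powr (1/P) * (1 - a k) powr (- 2 * (1/P)) = (1 - a k) powr (- (1/P))"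
        by (simp flip: powr_add)
      then show ?thesis unfolding powr_mult by (simp add: mult_ac)
    qed
    also have "\<dots> \<le> (1 - (a k)\<^sup>2) powr (1/P) * (1 - a k * (a k)\<^sup>2) powr (- 2 * (1/P))"
      using P ak a2 le3 pos by (intro mult_mono powr_mono2 powr_mono2') auto
    finally have "(1/4) ^ k * (3 powr (- 2 * (1/P)) * (1 - a k) powr (- (1/P))) \<le> c k ((a k)\<^sup>2)"
      unfolding c_def by (rule mult_left_mono) simp
    also have "\<dots> \<le> \<phi> ((a k)\<^sup>2)"
      unfolding \<phi>_def using sum_le_suminf[OF summ, of "(a k)\<^sup>2" "{k}"] c0 a2 by simp
    finally show "3 powr (- 2 * (1/P)) * (1/4) ^ k * (1 - a k) powr (- inv_exp p) \<le> \<phi> ((a k)\<^sup>2)"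
      by (simp add: inv mult_ac)
  qed simp
qed

section \<open>Lower bound for the derivative on the radius and necessity of the Carleson
  condition\<close>

context finite_measure_unit_interval
begin

lemma integrable_holomorphic_radius:
  assumes holg: "g holomorphic_on ball 0 1" and z: "norm z < 1"
  shows "integrable mu (\<lambda>t. g (of_real t * z))"
proof -
  have "compact (g ` cball 0 (norm z))"
    by (intro compact_continuous_image holomorphic_on_imp_continuous_on holomorphic_on_subset[OF holg]) (use z in auto)
  then obtain L where L: "\<And>w. w \<in> cball 0 (norm z) \<Longrightarrow> norm (g w) \<le> L"
    by (meson bounded_iff compact_imp_bounded imageI)
  show ?thesis
  proof (rule integrable_const_bound)
    have "norm (of_real t * z) \<le> norm z" if "t \<in> space mu" for t
      using that mult_right_mono[of t 1 "norm z"] by (simp add: norm_mult space_mu)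
    then show "AE t in mu. norm (g (of_real t * z)) \<le> L" by (intro AE_I2 L) simp
    show "(\<lambda>t. g (of_real t * z)) \<in> borel_measurable mu"
      by (intro measurable_mu_continuous continuous_on_radius_of_holomorphic[OF holg]) (use z in simp)
  qed
qed

text \<open>Monotonicity of \<open>\<phi>\<close> bounds the difference quotients from below, which avoids differentiating
  under the integral sign.\<close>
lemma norm_deriv_cesaro_ge:
  assumes holf: "f holomorphic_on ball 0 1"
    and f: "\<And>x. x \<in> {0..<1} \<Longrightarrow> f (of_real x) = of_real (\<phi> x)"
    and \<phi>: "\<And>x y. 0 \<le> x \<Longrightarrow> x \<le> y \<Longrightarrow> y < 1 \<Longrightarrow> 0 \<le> \<phi> x \<and> \<phi> x \<le> \<phi> y"
    and a: "1/2 \<le> a" "a < 1"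
  shows "\<phi> (a\<^sup>2) / 2 / (1 - a\<^sup>2)\<^sup>2 * measure mu {a..<1} \<le> norm (deriv (cesaro_like mu f) (of_real a))"
proof -
  define F where "F = cesaro_like mu f"
  define g where "g w = f w / (1 - w)" for w
  have holg: "g holomorphic_on ball 0 1" unfolding g_def by (rule holomorphic_cesaro_kernel[OF holf])
  define \<gamma> where "\<gamma> x = \<phi> x / (1 - x)" for x
  have g\<gamma>: "g (of_real x) = of_real (\<gamma> x)" if "x \<in> {0..<1}" for x
    using f[OF that] by (simp add: g_def \<gamma>_def)
  \<comment> \<open>For t at least a the points t a and t y are at least a^2, and t is at least 1/2;
    inserting these bounds in the difference quotient of \<open>\<gamma>\<close> gives
    \<open>D\<close>.\<close>
  define D where "D = \<phi> (a\<^sup>2) / 2 / (1 - a\<^sup>2)\<^sup>2"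
  have a2: "a\<^sup>2 < 1" "a\<^sup>2 \<le> a" using a mult_strict_mono[of a 1 a 1] by (auto simp: power2_eq_square mult_left_le)
  have tx: "t * x \<in> {0..<1}" if "t \<in> {0..<1}" "x \<in> {0..<1}" for t x :: real
    using that mult_strict_mono'[of t 1 x 1] by auto
  have diff: "(y - a) * (D * indicator {a..} t) \<le> \<gamma> (t * y) - \<gamma> (t * a)"
    if t: "t \<in> {0..<1}" and y: "a < y" "y < 1" for t y
  proof -
    have ta: "t * a \<in> {0..<1}" "t * y \<in> {0..<1}" using tx[OF t] a y by auto
    have le: "t * a \<le> t * y" using t y by (intro mult_left_mono) auto
    have \<phi>t: "0 \<le> \<phi> (t * a)" "\<phi> (t * a) \<le> \<phi> (t * y)" using \<phi>[of "t * a" "t * y"] ta le by auto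
    \<comment> \<open>Only the increase of 1 / (1 - x) is kept; that of \<open>\<phi>\<close> is
      nonnegative and dropped.\<close>
    have "\<phi> (t * a) * (t * (y - a) / ((1 - t * y) * (1 - t * a))) = \<phi> (t * a) / (1 - t * y) - \<gamma> (t * a)"
      using ta by (simp add: \<gamma>_def field_simps)
    also have "\<dots> \<le> \<gamma> (t * y) - \<gamma> (t * a)"
      unfolding \<gamma>_def using \<phi>t ta by (intro diff_right_mono divide_right_mono) auto
    finally have 1: "\<phi> (t * a) * (t * (y - a) / ((1 - t * y) * (1 - t * a))) \<le> \<gamma> (t * y) - \<gamma> (t * a)" .
    show ?thesis
    proof (cases "a \<le> t")
      case True
      have aa: "a\<^sup>2 \<le> t * a" using True a by (simp add: power2_eq_square mult_right_mono)
      have "\<phi> (a\<^sup>2) * ((1/2) * (y - a) / ((1 - a\<^sup>2) * (1 - a\<^sup>2)))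
          \<le> \<phi> (t * a) * (t * (y - a) / ((1 - t * y) * (1 - t * a)))"
        using \<phi>[of "a\<^sup>2" "t * a"] aa order_trans[OF aa le] ta a2 True a y
        by (intro mult_mono frac_le) auto
      with 1 True show ?thesis by (simp add: D_def power2_eq_square mult_ac)
    next
      case False
      have "0 \<le> \<phi> (t * a) * (t * (y - a) / ((1 - t * y) * (1 - t * a)))"
        using \<phi>t t ta y by (intro mult_nonneg_nonneg divide_nonneg_nonneg) auto
      with 1 False show ?thesis by simp
    qed
  qed
  have F_eq: "F (of_real x) = (\<integral>t. g (of_real t * of_real x) \<partial>mu)" if "x \<in> {0..<1}" for x
    using that by (simp add: F_def cesaro_like_def unit_disc_def g_def)
  have int: "integrable mu (\<lambda>t. g (of_real t * of_real x))" if "x \<in> {0..<1}" for x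
    by (rule integrable_holomorphic_radius[OF holg]) (use that in auto)
  have meas: "{a..<1} \<in> sets mu"
  proof -
    have "{a..<1} = {t\<in>space mu. 1 - t \<le> 1 - a}" using a by (auto simp: space_mu)
    then show ?thesis using sets_tail[of "1 - a"] by (simp only:)
  qed
  have quot: "D * measure mu {a..<1} \<le> Re ((F (of_real y) - F (of_real a)) / (of_real y - of_real a))"
    if y: "a < y" "y < 1" for y
  proof -
    have xy: "a \<in> {0..<1}" "y \<in> {0..<1}" using a y by auto
    have Dint: "integrable mu (\<lambda>t. (y - a) * (D * indicator {a..<1} t))"
      using meas by (intro integrable_mult_right integrable_real_indicator) (auto simp: emeasure_eq_measure)
    have "(y - a) * (D * measure mu {a..<1}) = (\<integral>t. (y - a) * (D * indicator {a..<1} t) \<partial>mu)"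
      using meas by (simp add: measure_def[symmetric])
    also have "\<dots> \<le> (\<integral>t. Re (g (of_real t * of_real y) - g (of_real t * of_real a)) \<partial>mu)"
    proof (rule integral_mono[OF Dint])
      show "integrable mu (\<lambda>t. Re (g (of_real t * of_real y) - g (of_real t * of_real a)))"
        using int[OF xy(1)] int[OF xy(2)] by (intro integrable_Re Bochner_Integration.integrable_diff)
      fix t assume "t \<in> space mu"
      then have t: "t \<in> {0..<1}" by (simp add: space_mu)
      have "Re (g (of_real t * of_real y) - g (of_real t * of_real a)) = \<gamma> (t * y) - \<gamma> (t * a)"
        using g\<gamma>[OF tx[OF t xy(1)]] g\<gamma>[OF tx[OF t xy(2)]] by simp
      then show "(y - a) * (D * indicator {a..<1} t) \<le> Re (g (of_real t * of_real y) - g (of_real t * of_real a))"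
        using diff[OF t y] t by (simp add: indicator_def)
    qed
    also have "\<dots> = Re (F (of_real y) - F (of_real a))"
      using int[OF xy(1)] int[OF xy(2)] by (simp add: F_eq[OF xy(1)] F_eq[OF xy(2)])
    finally have "D * measure mu {a..<1} \<le> Re (F (of_real y) - F (of_real a)) / (y - a)"
      using y by (simp add: field_simps)
    then show ?thesis using Re_divide_of_real[of "F (of_real y) - F (of_real a)" "y - a"] by simp
  qed
  have "F holomorphic_on ball 0 1" unfolding F_def by (rule holomorphic_cesaro_like[OF holf])
  then have "(F has_field_derivative deriv F (of_real a)) (at (of_real a))"
    by (rule holomorphic_derivI) (use a in auto)
  then have lim: "((\<lambda>w. (F w - F (of_real a)) / (w - of_real a)) \<longlongrightarrow> deriv F (of_real a)) (at (of_real a))"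
    by (simp add: has_field_derivative_iff)
  \<comment> \<open>The complex derivative exists by holomorphy, so its real part is the limit of
    the real quotients from the right and inherits their lower bound.\<close>
  have "filterlim (of_real :: real \<Rightarrow> complex) (at (of_real a)) (at_right a)"
    unfolding filterlim_at by (auto intro!: tendsto_intros simp: eventually_at_filter)
  from filterlim_compose[OF lim this]
  have "((\<lambda>y. Re ((F (of_real y) - F (of_real a)) / (of_real y - of_real a))) \<longlongrightarrow> Re (deriv F (of_real a))) (at_right a)"
    by (rule tendsto_Re)
  moreover have "\<forall>\<^sub>F y in at_right a. D * measure mu {a..<1} \<le> Re ((F (of_real y) - F (of_real a)) / (of_real y - of_real a))"
    using eventually_at_right_less[of a] eventually_at_right_real[OF a(2)]
    by eventually_elim (use quot in auto)
  ultimately have "D * measure mu {a..<1} \<le> Re (deriv F (of_real a))"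
    by (rule tendsto_lowerbound) simp
  also have "\<dots> \<le> norm (deriv F (of_real a))" by (rule complex_Re_le_cmod)
  finally show ?thesis by (simp add: D_def F_def)
qed

lemma carleson_of_cesaro_bloch:
  assumes p: "0 < p" and lam: "0 < lam" "lam \<le> 1"
    and bl: "\<And>f. f \<in> hardy p \<Longrightarrow> cesaro_like mu f \<in> bloch_type ((3 - lam) / 2)"
  shows "carleson mu ((1 + lam) / 2 + inv_exp p)"
proof (rule ccontr)
  define s where "s = (1 + lam) / 2 + inv_exp p"
  have "0 \<le> inv_exp p" using p by (cases p) (auto simp: inv_exp_def)
  then have s0: "0 < s" using lam by (simp add: s_def add_pos_nonneg)
  \<comment> \<open>Adding \<open>T\<close> to the required ratio forces every chosen point to be at
    least 1/2: at a smaller one, \<open>T * (1 - a j) powr s\<close> would already reach the total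
    mass.\<close>
  define T where "T = measure mu (space mu) * 2 powr s"
  assume "\<not> carleson mu ((1 + lam) / 2 + inv_exp p)"
  then have *: "\<exists>t\<in>{0..<1}. C * (1 - t) powr s < measure mu {t..<1}" if "0 < C" for C
    using that by (force simp: carleson_def s_def not_le)
  have T0: "0 \<le> T" by (simp add: T_def)
  have "\<exists>t. t \<in> {0..<1} \<and> (16 ^ j + T) * (1 - t) powr s < measure mu {t..<1}" for j :: nat
    using *[of "16 ^ j + T"] T0 add_pos_nonneg[of "16 ^ j" T] by auto
  then obtain a where a: "\<And>j::nat. a j \<in> {0..<1}"
    "\<And>j::nat. (16 ^ j + T) * (1 - a j) powr s < measure mu {a j..<1}" by metis
  have ahalf: "1/2 \<le> a j" for j
  proof (rule ccontr)
    assume "\<not> 1/2 \<le> a j"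
    then have "(1/2) powr s \<le> (1 - a j) powr s" using s0 by (intro powr_mono2) auto
    then have "T * (1/2) powr s \<le> (16 ^ j + T) * (1 - a j) powr s" using T0 by (intro mult_mono) auto
    also have "\<dots> < measure mu {a j..<1}" by (rule a)
    also have "\<dots> \<le> measure mu (space mu)" by (rule bounded_measure)
    finally show False by (simp add: T_def powr_divide)
  qed
  have a01: "0 < a j" "a j < 1" for j using a(1)[of j] ahalf[of j] by auto
  obtain f \<phi> \<kappa> where f: "f \<in> hardy p" "0 < \<kappa>"
    "\<And>x. x \<in> {0..<1} \<Longrightarrow> f (of_real x) = of_real (\<phi> x)"
    "\<And>x y. 0 \<le> x \<Longrightarrow> x \<le> y \<Longrightarrow> y < 1 \<Longrightarrow> 0 \<le> \<phi> x \<and> \<phi> x \<le> \<phi> y"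
    "\<And>k. \<kappa> * (1/4) ^ k * (1 - a k) powr (- inv_exp p) \<le> \<phi> ((a k)\<^sup>2)"
    using hardy_test_function[of p a, OF p a01] by metis
  have holf: "f holomorphic_on ball 0 1" using f(1) by (simp add: hardy_def analytic_disc_def unit_disc_def)
  obtain M where M: "\<And>z. z \<in> ball 0 1 \<Longrightarrow> (1 - (norm z)\<^sup>2) powr ((3 - lam) / 2) * norm (deriv (cesaro_like mu f) z) \<le> M"
    using bl[OF f(1)] unfolding bloch_type_def unit_disc_def by blast
  \<comment> \<open>The ratio 16^j against the weight 4^-j leaves 4^j. The 8 is the factor 2 in the
    derivative bound times the 4 from \<open>(2 * u)\<^sup>2\<close>.\<close>
  have "4 ^ j \<le> 8 * M / \<kappa>" for j :: nat
  proof -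
    define u where "u = 1 - a j"
    have u: "0 < u" "u \<le> 1" using a01[of j] by (auto simp: u_def)
    have u2: "u \<le> 1 - (a j)\<^sup>2" "1 - (a j)\<^sup>2 \<le> 2 * u"
      using a01[of j] by (auto simp: u_def power2_eq_square algebra_simps mult_left_le)
         (use zero_le_power2[of "1 - a j"] in \<open>simp add: power2_eq_square algebra_simps\<close>)
    have "\<kappa> * (1/4) ^ j * u powr (- inv_exp p) / 2 / (2 * u)\<^sup>2 * (16 ^ j * u powr s)
       \<le> \<phi> ((a j)\<^sup>2) / 2 / (1 - (a j)\<^sup>2)\<^sup>2 * measure mu {a j..<1}"
    proof (rule mult_mono)
      have "(1 - (a j)\<^sup>2)\<^sup>2 \<le> (2 * u)\<^sup>2" using u u2 by (intro power_mono) auto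
      then show "\<kappa> * (1/4) ^ j * u powr (- inv_exp p) / 2 / (2 * u)\<^sup>2 \<le> \<phi> ((a j)\<^sup>2) / 2 / (1 - (a j)\<^sup>2)\<^sup>2"
        using f(5)[of j] f(2) u u2 f(4)[of "(a j)\<^sup>2" "(a j)\<^sup>2"]
        by (intro frac_le) (auto simp: u_def[symmetric] intro!: divide_right_mono zero_less_power)
      have "16 ^ j * u powr s \<le> (16 ^ j + T) * u powr s" using T0 by (intro mult_right_mono) auto
      then show "16 ^ j * u powr s \<le> measure mu {a j..<1}" using a(2)[of j] by (simp add: u_def)
      show "0 \<le> \<phi> ((a j)\<^sup>2) / 2 / (1 - (a j)\<^sup>2)\<^sup>2"
        using f(4)[of "(a j)\<^sup>2" "(a j)\<^sup>2"] u u2 by simp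
    qed (use f(2) in auto)
    also have "\<dots> \<le> norm (deriv (cesaro_like mu f) (of_real (a j)))"
      by (rule norm_deriv_cesaro_ge[OF holf f(3,4) ahalf a01(2)])
    also have "\<kappa> * (1/4) ^ j * u powr (- inv_exp p) / 2 / (2 * u)\<^sup>2 * (16 ^ j * u powr s)
        = \<kappa> * 4 ^ j / 8 * (u powr (- inv_exp p) * u powr s / u powr 2)"
    proof -
      have "(4::real) ^ j = (1/4) ^ j * 16 ^ j" by (simp flip: power_mult_distrib)
      then show ?thesis using u by (simp add: power2_eq_square)
    qed
    finally have 1: "\<kappa> * 4 ^ j / 8 * (u powr (- inv_exp p) * u powr s / u powr 2)
        \<le> norm (deriv (cesaro_like mu f) (of_real (a j)))" .
    have "\<kappa> * 4 ^ j / 8 = u powr ((3 - lam) / 2) * (\<kappa> * 4 ^ j / 8 * (u powr (- inv_exp p) * u powr s / u powr 2))"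
    proof -
      have "u powr ((3 - lam) / 2) * (u powr (- inv_exp p) * u powr s / u powr 2)
         = u powr ((3 - lam) / 2 + (- inv_exp p + s - 2))"
        using u by (simp only: powr_add powr_diff)
      \<comment> \<open>The Bloch weight, the growth of the test function, the measure of the tail
        and the squared kernel balance exactly at the critical Carleson exponent.\<close>
      also have "(3 - lam) / 2 + (- inv_exp p + s - 2) = 0" by (simp add: s_def field_simps)
      finally show ?thesis using u by (simp add: mult_ac)
    qed
    also have "\<dots> \<le> (1 - (a j)\<^sup>2) powr ((3 - lam) / 2) * norm (deriv (cesaro_like mu f) (of_real (a j)))"
      using u u2 lam f(2) by (intro mult_mono powr_mono2 1) auto
    also have "\<dots> \<le> M" using M[of "of_real (a j)"] a01[of j] by simp
    finally show ?thesis using f(2) by (simp add: field_simps)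
  qed
  moreover obtain j :: nat where "8 * M / \<kappa> < 4 ^ j" using real_arch_pow[of 4 "8 * M / \<kappa>"] by auto
  ultimately show False by (meson not_le)
qed

end

text \<open>Sufficiency places the image in the smaller space \<open>morrey lam\<close>, and
  necessity starts from the larger space \<open>bloch_type ((3 - lam) / 2)\<close>; hence one
  criterion for every X between them.\<close>

theorem theorem1p1:
  fixes p :: ereal and lam :: real and mu :: "real measure"
    and X :: "(complex \<Rightarrow> complex) set" and N :: "(complex \<Rightarrow> complex) \<Rightarrow> real"
  assumes "0 < p"
    and "0 < lam" and "lam \<le> 1"
    and "finite_measure mu"
    and "sets mu = sets (restrict_space borel {0..<1::real})"
    and "banach_analytic_space X N"
    and "morrey lam \<subseteq> X"
    and "X \<subseteq> bloch_type ((3 - lam) / 2)"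
  shows "(\<forall>f\<in>hardy p. cesaro_like mu f \<in> X) \<longleftrightarrow>
         carleson mu ((1 + lam) / 2 + inv_exp p)"
proof
  interpret finite_measure_unit_interval mu
    using assms(4,5) by (simp add: finite_measure_unit_interval_def finite_measure_unit_interval_axioms_def)
  show "carleson mu ((1 + lam) / 2 + inv_exp p)" if "\<forall>f\<in>hardy p. cesaro_like mu f \<in> X"
    using that assms by (intro carleson_of_cesaro_bloch) auto
  show "\<forall>f\<in>hardy p. cesaro_like mu f \<in> X" if carl: "carleson mu ((1 + lam) / 2 + inv_exp p)"
  proof
    fix f assume f: "f \<in> hardy p"
    then obtain C where C: "0 \<le> C" "\<And>z. norm z < 1 \<Longrightarrow> norm (f z) \<le> C * (1 - norm z) powr (- inv_exp p)"
      using hardy_growth assms(1) by blast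
    interpret cesaro_growth mu f C "inv_exp p" lam
    proof
      show "f holomorphic_on ball 0 1" using f by (simp add: hardy_def analytic_disc_def unit_disc_def)
      show "0 \<le> inv_exp p" using assms(1) by (cases p) (auto simp: inv_exp_def)
    qed (use C assms carl in auto)
    show "cesaro_like mu f \<in> X" using cesaro_like_in_morrey assms(7) by blast
  qed
qed

end
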